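(* Let $X$ be an unbounded intrinsic $\delta$-hyperbolic space, let $o,p\in X$ be fixed, let $0<h<1/13$, and let $\epsilon_0=\epsilon_0(\delta,h)>0$ be a Gehring–Hayman constant for $(\delta,h)$ (as defined in the context) with $\epsilon_0<\min\{1,\tfrac{1}{5\delta}\}$. Let $0<\epsilon\le\epsilon_0$, let $X_\epsilon=(X,d_\epsilon)$ be the conformal deformation of $X$ with density $\rho_\epsilon(x)=e^{-\epsilon|x-p|}$, let $\partial_\epsilon X$ be the metric boundary of $X_\epsilon$, let $\delta_\infty X$ be the Gromov boundary of $X$, and let $\theta_{\epsilon,o}$ be as in the context. Then the natural map $\delta_\infty X\to\partial_\epsilon X$, sending the equivalence class of a Gromov sequence $\{u_n\}$ to the $d_\epsilon$-limit of $\{u_n\}$, is well defined, is a bijection, and is a quasi-isometry from $(\delta_\infty X,\theta_{\epsilon,o})$ onto $(\partial_\epsilon X,d_\epsilon)$; that is, there is $A\ge1$ such that, writing $f$ for this map, $\theta_{\epsilon,o}(\xi,\eta)/A\le d_\epsilon(f(\xi),f(\eta))\le A\,\theta_{\epsilon,o}(\xi,\eta)$ for all $\xi,\eta\in\delta_\infty X$.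
   Context: The distance in $X$ is written $|x-y|$. An arc is a subset homeomorphic to a compact real interval; $\alpha:x\curvearrowright y$ means $\alpha$ is an arc with endpoints $x,y$; $l(\alpha)$ is its length. $X$ is intrinsic if $|x-y|=\inf\{l(\alpha):\alpha:x\curvearrowright y\}$ for all $x,y$. For $h\ge0$, an arc $\alpha:x\curvearrowright y$ is $h$-short if $l(\alpha)\le|x-y|+h$. The Gromov product is defined by $2(x|y)_p=|x-p|+|y-p|-|x-y|$; $X$ is $\delta$-hyperbolic ($\delta\ge0$) if $(x|z)_p\ge\min\{(x|y)_p,(y|z)_p\}-\delta$ for all $x,y,z,p\in X$. Spaces are not assumed geodesic or proper. Conformal deformation: $\rho_\epsilon(x)=\exp(-\epsilon|x-p|)$, $d_\epsilon(x,y)=\inf_\gamma\int_\gamma\rho_\epsilon\,ds$ over all rectifiable curves $\gamma$ joining $x$ and $y$, $X_\epsilon=(X,d_\epsilon)$. The metric boundary is $\partial_\epsilon X=\overline{X_\epsilon}\setminus X_\epsilon$, where $\overline{X_\epsilon}$ is the metric completion of $X_\epsilon$; the extension of $d_\epsilon$ to the completion is again written $d_\epsilon$. Gehring–Hayman constant: given $\delta\ge0$ and $0<h<1/13$, $\epsilon_0>0$ is called a Gehring–Hayman constant for $(\delta,h)$ if there is $K>0$ such that for every intrinsic $\delta$-hyperbolic space $Y$, every $0<\epsilon\le\epsilon_0$ and every continuous $\rho:Y\to(0,\infty)$ with $e^{-\epsilon|x-y|}\le\rho(x)/\rho(y)\le e^{\epsilon|x-y|}$ for all $x,y\in Y$,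 one has $l_\rho(\alpha)\le K\,l_\rho(\gamma)$ whenever $\alpha:x\curvearrowright y$ is an $h$-short arc with $l(\alpha)\le2|x-y|$ and $\gamma$ is any curve with the same endpoints; here $l_\rho(\gamma)=\int_\gamma\rho\,ds$. (Such a constant, depending only on $\delta$ and $h$, is known to exist.) Gromov boundary: a sequence $\{x_n\}$ in $X$ is a Gromov sequence if $(x_i|x_j)_o\to\infty$ as $i,j\to\infty$; two Gromov sequences $\{x_n\},\{y_n\}$ are equivalent if $(x_i|y_i)_o\to\infty$ as $i\to\infty$. $\delta_\infty X$ is the set of equivalence classes. For $\xi,\eta\in\delta_\infty X$, $(\xi|\eta)_o=\inf\liminf_{i\to\infty}(x_i|y_i)_o$, the infimum being over all $\{x_i\}\in\xi$, $\{y_i\}\in\eta$; if one of the arguments is a point of $X$, the corresponding sequence is replaced by that constant point. For $0<\epsilon<1$ and $x,y\in X\cup\delta_\infty X$ put $\tau_{\epsilon,o}(x,y)=e^{-\epsilon(x|y)_o}$ (with $e^{-\infty}=0$). If $\epsilon\delta<1/5$, it is known that there is a metametric $\theta_{\epsilon,o}$ on $X\cup\delta_\infty X$ (symmetric, nonnegative, satisfying the triangle inequality, and with $\theta_{\epsilon,o}(x,y)=0$ implying $x=y$) such that $\tfrac12\tau_{\epsilon,o}\le\theta_{\epsilon,o}\le\tau_{\epsilon,o}$, and it restricts to a metric on $\delta_\infty X$; $\theta_{\epsilon,o}$ denotes such a metametric. When $\delta=0$, $\tfrac1{5\delta}$ is read as $\infty$.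
   Formalization: That the natural map is onto the metric boundary (hence a bijection) is claimed only when X is complete, since it fails otherwise, e.g. for X = (0,∞); well-definedness, injectivity and the quasi-isometry bounds hold without completeness. *)

theory Defs
  imports "HOL-Analysis.Analysis"
begin

section \<open>Curves, arcs and length\<close>

text \<open>A curve or arc is represented by a parametrization \<open>g\<close> on a compact interval \<open>{a..b}\<close>.
  The degenerate case \<open>a = b\<close> is allowed, so that one-point arcs join a point to itself.\<close>

definition curve_between ::
    "'a metric \<Rightarrow> (real \<Rightarrow> 'a) \<Rightarrow> real \<Rightarrow> real \<Rightarrow> 'a \<Rightarrow> 'a \<Rightarrow> bool" where
  "curve_between X g a b x y \<longleftrightarrow>
     a \<le> b \<and> continuous_map (top_of_set {a..b}) (mtopology_of X) g \<and> g a = x \<and> g b = y"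

definition arc_between ::
    "'a metric \<Rightarrow> (real \<Rightarrow> 'a) \<Rightarrow> real \<Rightarrow> real \<Rightarrow> 'a \<Rightarrow> 'a \<Rightarrow> bool" where
  "arc_between X g a b x y \<longleftrightarrow>
     a \<le> b \<and> embedding_map (top_of_set {a..b}) (mtopology_of X) g \<and> g a = x \<and> g b = y"

definition path_length :: "'a metric \<Rightarrow> (real \<Rightarrow> 'a) \<Rightarrow> real \<Rightarrow> real \<Rightarrow> ennreal" where
  "path_length X g a b =
     (SUP (n, t) \<in> {(n :: nat, t :: nat \<Rightarrow> real).
                     (\<forall>i\<le>n. t i \<in> {a..b}) \<and> (\<forall>i<n. t i \<le> t (Suc i))}.
        \<Sum>i<n. ennreal (mdist X (g (t i)) (g (t (Suc i)))))"

definition rectifiable :: "'a metric \<Rightarrow> (real \<Rightarrow> 'a) \<Rightarrow> real \<Rightarrow> real \<Rightarrow> bool" where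
  "rectifiable X g a b \<longleftrightarrow> path_length X g a b < \<infinity>"

definition intrinsic :: "'a metric \<Rightarrow> bool" where
  "intrinsic X \<longleftrightarrow>
     (\<forall>x\<in>mspace X. \<forall>y\<in>mspace X.
        ennreal (mdist X x y) = (INF (g, a, b) \<in> {(g, a, b). arc_between X g a b x y}.
                                   path_length X g a b))"

definition short_arc ::
    "'a metric \<Rightarrow> real \<Rightarrow> (real \<Rightarrow> 'a) \<Rightarrow> real \<Rightarrow> real \<Rightarrow> 'a \<Rightarrow> 'a \<Rightarrow> bool" where
  "short_arc X h g a b x y \<longleftrightarrow>
     arc_between X g a b x y \<and> path_length X g a b \<le> ennreal (mdist X x y + h)"


section \<open>Gromov hyperbolicity\<close>

definition gromov_product :: "'a metric \<Rightarrow> 'a \<Rightarrow> 'a \<Rightarrow> 'a \<Rightarrow> real" where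
  "gromov_product X p x y = (mdist X x p + mdist X y p - mdist X x y) / 2"

definition hyperbolic_space :: "real \<Rightarrow> 'a metric \<Rightarrow> bool" where
  "hyperbolic_space \<delta> X \<longleftrightarrow> 0 \<le> \<delta> \<and>
     (\<forall>x\<in>mspace X. \<forall>y\<in>mspace X. \<forall>z\<in>mspace X. \<forall>p\<in>mspace X.
        min (gromov_product X p x y) (gromov_product X p y z) - \<delta> \<le> gromov_product X p x z)"


section \<open>Line integrals and conformal deformation\<close>

text \<open>The arc length parametrization of a rectifiable curve: \<open>u\<close> is sent to the point \<open>g t\<close> such
  that \<open>g\<close> restricted to \<open>{a..t}\<close> has length \<open>u\<close>. Two such \<open>t\<close> give the same point, since \<open>g\<close> is
  constant between them.\<close>

definition arclength_param ::
    "'a metric \<Rightarrow> (real \<Rightarrow> 'a) \<Rightarrow> real \<Rightarrow> real \<Rightarrow> real \<Rightarrow> 'a" where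
  "arclength_param X g a b u = g (SOME t. t \<in> {a..b} \<and> path_length X g a t = ennreal u)"

text \<open>The integral of \<open>\<rho>\<close> with respect to arc length; only meaningful for rectifiable curves.\<close>

definition line_integral ::
    "'a metric \<Rightarrow> ('a \<Rightarrow> real) \<Rightarrow> (real \<Rightarrow> 'a) \<Rightarrow> real \<Rightarrow> real \<Rightarrow> real" where
  "line_integral X \<rho> g a b =
     integral {0..enn2real (path_length X g a b)} (\<lambda>u. \<rho> (arclength_param X g a b u))"

definition conformal_density :: "'a metric \<Rightarrow> 'a \<Rightarrow> real \<Rightarrow> 'a \<Rightarrow> real" where
  "conformal_density X p \<epsilon> x = exp (- \<epsilon> * mdist X x p)"

text \<open>The value outside \<open>mspace X\<close> is set to 0 because \<open>Metric_space\<close> requires distance functions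
  to be nonnegative everywhere.\<close>

definition conformal_dist :: "'a metric \<Rightarrow> 'a \<Rightarrow> real \<Rightarrow> 'a \<Rightarrow> 'a \<Rightarrow> real" where
  "conformal_dist X p \<epsilon> x y =
     (if x \<in> mspace X \<and> y \<in> mspace X
      then Inf {line_integral X (conformal_density X p \<epsilon>) g a b |g a b.
                  curve_between X g a b x y \<and> rectifiable X g a b}
      else 0)"

text \<open>The comparison curve \<open>\<gamma>\<close> may be restricted to rectifiable ones: for the others the
  \<open>\<rho>\<close>-length is infinite. The spaces \<open>Y\<close> are all metric spaces with points in the type \<open>'a\<close>.\<close>

definition gehring_hayman_constant :: "'a itself \<Rightarrow> real \<Rightarrow> real \<Rightarrow> real \<Rightarrow> bool" where
  "gehring_hayman_constant TYPE('a) \<delta> h \<epsilon>\<^sub>0 \<longleftrightarrow> 0 < \<epsilon>\<^sub>0 \<and>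
     (\<exists>K>0. \<forall>(Y :: 'a metric) \<epsilon> \<rho>.
        intrinsic Y \<and> hyperbolic_space \<delta> Y \<and> 0 < \<epsilon> \<and> \<epsilon> \<le> \<epsilon>\<^sub>0 \<and>
        continuous_map (mtopology_of Y) euclideanreal \<rho> \<and> (\<forall>x\<in>mspace Y. 0 < \<rho> x) \<and>
        (\<forall>x\<in>mspace Y. \<forall>y\<in>mspace Y.
           exp (- \<epsilon> * mdist Y x y) \<le> \<rho> x / \<rho> y \<and> \<rho> x / \<rho> y \<le> exp (\<epsilon> * mdist Y x y))
        \<longrightarrow> (\<forall>x y \<alpha> a b \<gamma> c e.
              short_arc Y h \<alpha> a b x y \<and> path_length Y \<alpha> a b \<le> ennreal (2 * mdist Y x y) \<and>
              curve_between Y \<gamma> c e x y \<and> rectifiable Y \<gamma> c e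
              \<longrightarrow> line_integral Y \<rho> \<alpha> a b \<le> K * line_integral Y \<rho> \<gamma> c e))"


section \<open>Metric completion and metric boundary\<close>

text \<open>\<open>C\<close> together with the isometric embedding \<open>\<iota>\<close> is a completion of the set \<open>M\<close> with the
  distance function \<open>d\<close>; its metric boundary is then \<open>mspace C - \<iota> ` M\<close>. If \<open>M\<close> is an
  intrinsic hyperbolic space that is not complete in its original metric, then the metric boundary
  of its conformal deformation also contains points that are limits of bounded sequences, hence not
  limits of Gromov sequences: the open ray \<open>{0<..}\<close> has two metric boundary points but only one
  Gromov boundary point.\<close>

definition is_metric_completion ::
    "'a set \<Rightarrow> ('a \<Rightarrow> 'a \<Rightarrow> real) \<Rightarrow> 'c metric \<Rightarrow> ('a \<Rightarrow> 'c) \<Rightarrow> bool" where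
  "is_metric_completion M d C \<iota> \<longleftrightarrow>
     mcomplete_of C \<and> \<iota> \<in> M \<rightarrow> mspace C \<and>
     (\<forall>x\<in>M. \<forall>y\<in>M. mdist C (\<iota> x) (\<iota> y) = d x y) \<and>
     mtopology_of C closure_of (\<iota> ` M) = mspace C"

lemma (in Metric_space) ex_metric_completion:
  "\<exists>(C :: ('a \<Rightarrow> real) metric) \<iota>. is_metric_completion M d C \<iota>"
  using metric_completion unfolding is_metric_completion_def by metis


section \<open>Gromov boundary\<close>

definition gromov_sequence :: "'a metric \<Rightarrow> 'a \<Rightarrow> (nat \<Rightarrow> 'a) \<Rightarrow> bool" where
  "gromov_sequence X q u \<longleftrightarrow> range u \<subseteq> mspace X \<and>
     filterlim (\<lambda>(i, j). gromov_product X q (u i) (u j)) at_top (sequentially \<times>\<^sub>F sequentially)"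

definition gromov_equiv :: "'a metric \<Rightarrow> 'a \<Rightarrow> ((nat \<Rightarrow> 'a) \<times> (nat \<Rightarrow> 'a)) set" where
  "gromov_equiv X q = {(u, v). gromov_sequence X q u \<and> gromov_sequence X q v \<and>
     filterlim (\<lambda>i. gromov_product X q (u i) (v i)) at_top sequentially}"

definition gromov_boundary :: "'a metric \<Rightarrow> 'a \<Rightarrow> (nat \<Rightarrow> 'a) set set" where
  "gromov_boundary X q = {u. gromov_sequence X q u} // gromov_equiv X q"

text \<open>The union of \<open>X\<close> and its Gromov boundary is represented as a disjoint sum.\<close>

definition gromov_closure :: "'a metric \<Rightarrow> 'a \<Rightarrow> ('a + (nat \<Rightarrow> 'a) set) set" where
  "gromov_closure X q = mspace X <+> gromov_boundary X q"

fun representing_sequences :: "'a + (nat \<Rightarrow> 'a) set \<Rightarrow> (nat \<Rightarrow> 'a) set" where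
  "representing_sequences (Inl x) = {\<lambda>_. x}"
| "representing_sequences (Inr \<xi>) = \<xi>"

definition ext_gromov_product ::
    "'a metric \<Rightarrow> 'a \<Rightarrow> 'a + (nat \<Rightarrow> 'a) set \<Rightarrow> 'a + (nat \<Rightarrow> 'a) set \<Rightarrow> ereal" where
  "ext_gromov_product X q x y =
     (INF u\<in>representing_sequences x. INF v\<in>representing_sequences y.
        liminf (\<lambda>i. ereal (gromov_product X q (u i) (v i))))"

definition visual_tau ::
    "'a metric \<Rightarrow> 'a \<Rightarrow> real \<Rightarrow> 'a + (nat \<Rightarrow> 'a) set \<Rightarrow> 'a + (nat \<Rightarrow> 'a) set \<Rightarrow> real" where
  "visual_tau X q \<epsilon> x y =
     (if ext_gromov_product X q x y = \<infinity> then 0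
      else exp (- \<epsilon> * real_of_ereal (ext_gromov_product X q x y)))"

text \<open>The last clause says that \<open>\<theta>\<close> restricts to a metric on the Gromov boundary.\<close>

definition visual_metametric ::
    "'a metric \<Rightarrow> 'a \<Rightarrow> real \<Rightarrow> ('a + (nat \<Rightarrow> 'a) set \<Rightarrow> 'a + (nat \<Rightarrow> 'a) set \<Rightarrow> real) \<Rightarrow> bool" where
  "visual_metametric X q \<epsilon> \<theta> \<longleftrightarrow>
     (\<forall>x\<in>gromov_closure X q. \<forall>y\<in>gromov_closure X q.
        0 \<le> \<theta> x y \<and> \<theta> x y = \<theta> y x \<and> (\<theta> x y = 0 \<longrightarrow> x = y) \<and>
        visual_tau X q \<epsilon> x y / 2 \<le> \<theta> x y \<and> \<theta> x y \<le> visual_tau X q \<epsilon> x y) \<and>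
     (\<forall>x\<in>gromov_closure X q. \<forall>y\<in>gromov_closure X q. \<forall>z\<in>gromov_closure X q.
        \<theta> x z \<le> \<theta> x y + \<theta> y z) \<and>
     (\<forall>\<xi>\<in>gromov_boundary X q. \<theta> (Inr \<xi>) (Inr \<xi>) = 0)"

end

theory Submission
  imports Defs
begin

text \<open>
  Write \<open>(x|y)\<close> for the Gromov product with base point \<open>p\<close>. The theorem rests on the estimate
  \<open>c * exp (- \<epsilon> * (x|y)) * min 1 |x - y| \<le> d\<^sub>\<epsilon> x y \<le> C * exp (- \<epsilon> * (x|y))\<close>,
  where \<open>d\<^sub>\<epsilon>\<close> is the conformal distance.

  For the upper bound, integrate the density along a curve \<open>\<alpha>\<close> from \<open>x\<close> to \<open>y\<close>, parametrized
  by arc length, whose length exceeds \<open>|x - y|\<close> by at most \<open>1\<close>. With \<open>u\<^sub>0 = (y|p)\<^sub>x\<close>, triangle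
  inequalities give \<open>|\<alpha> u - p| \<ge> (x|y) + |u - u\<^sub>0| - 1\<close>, and \<open>exp (- \<epsilon> * |u - u\<^sub>0|)\<close> has integral at most
  \<open>2 / \<epsilon>\<close> (\<open>conformal_dist_le_exp_gromov_product\<close>). For the lower bound, hyperbolicity shows that on
  a short arc the point at parameter \<open>u\<^sub>0\<close> has distance at most \<open>(x|y) + 2 * \<delta> + h\<close> from \<open>p\<close>, so
  that a piece of length \<open>min 1 |x - y|\<close> around it contributes enough to the integral. The
  Gehring--Hayman inequality carries this over from the short arc to all curves
  (\<open>conformal_dist_ge_exp_gromov_product\<close>).

  The rest follows from this estimate and \<open>d\<^sub>\<epsilon> x y \<le> |x - y|\<close> (locale \<open>visual_distance\<close>). By the upper bound Gromov
  sequences are Cauchy for \<open>d\<^sub>\<epsilon>\<close> and equivalent ones have the same limit; by the lower bound the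
  limit is not a point of \<open>X\<close>. Taking limits along sequences that represent \<open>\<xi>\<close> and \<open>\<eta>\<close>, where
  \<open>|u n - v n|\<close> eventually exceeds \<open>1\<close> whenever \<open>(u n|v n)\<close> stays bounded, compares the distance of
  the limits with \<open>exp (- \<epsilon> * (\<xi>|\<eta>))\<close>, hence with \<open>\<theta>\<close> (\<open>boundary_dist_bounds\<close>). If \<open>X\<close> is complete, a
  sequence of \<open>X\<close> that converges to a point of the metric boundary must leave all balls, and then
  the lower bound makes it a Gromov sequence (\<open>approximating_sequence_gromov\<close>); so the
  boundary map is onto.
\<close>


section \<open>Length of curves\<close>

definition subdivision :: "real \<Rightarrow> real \<Rightarrow> nat \<Rightarrow> (nat \<Rightarrow> real) \<Rightarrow> bool" where
  "subdivision a b n t \<longleftrightarrow> (\<forall>i\<le>n. t i \<in> {a..b}) \<and> (\<forall>i<n. t i \<le> t (Suc i))"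

definition polygon_length :: "'a metric \<Rightarrow> (real \<Rightarrow> 'a) \<Rightarrow> (nat \<Rightarrow> real) \<Rightarrow> nat \<Rightarrow> real" where
  "polygon_length X g t n = (\<Sum>i<n. mdist X (g (t i)) (g (t (Suc i))))"

lemma polygon_length_nonneg: "0 \<le> polygon_length X g t n"
  unfolding polygon_length_def by (simp add: sum_nonneg)

lemma path_length_eq_SUP:
  "path_length X g a b =
     (SUP (n, t) \<in> {(n, t). subdivision a b n t}. ennreal (polygon_length X g t n))"
  unfolding path_length_def subdivision_def polygon_length_def by simp

lemma polygon_length_le_path_length:
  "subdivision a b n t \<Longrightarrow> ennreal (polygon_length X g t n) \<le> path_length X g a b"
  unfolding path_length_eq_SUP by (rule SUP_upper2[where i = "(n, t)"]) auto

lemma subdivision_min: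
  "subdivision a b n t \<Longrightarrow> a \<le> c \<Longrightarrow> subdivision a c n (\<lambda>i. min (t i) c)"
  unfolding subdivision_def by (auto simp: min_le_iff_disj)

lemma subdivision_max:
  "subdivision a b n t \<Longrightarrow> c \<le> b \<Longrightarrow> subdivision c b n (\<lambda>i. max (t i) c)"
  unfolding subdivision_def by (auto simp: le_max_iff_disj)

lemma subdivision_clamp:
  "subdivision a b n t \<Longrightarrow> c \<le> d \<Longrightarrow> subdivision c d n (\<lambda>i. max c (min d (t i)))"
  unfolding subdivision_def by (auto simp: le_max_iff_disj min_le_iff_disj)

lemma path_length_least:
  "(\<And>n t. subdivision a b n t \<Longrightarrow> ennreal (polygon_length X g t n) \<le> c)
     \<Longrightarrow> path_length X g a b \<le> c"
  unfolding path_length_eq_SUP by (rule SUP_least) auto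

lemma less_path_lengthE:
  assumes "c < path_length X g a b"
  obtains n t where "subdivision a b n t" "c < ennreal (polygon_length X g t n)"
  using assms unfolding path_length_eq_SUP less_SUP_iff by auto

lemma mdist_le_path_length:
  assumes "a \<le> b"
  shows "ennreal (mdist X (g a) (g b)) \<le> path_length X g a b"
proof -
  have "subdivision a b 1 (\<lambda>i. if i = 0 then a else b)"
    using assms by (auto simp: subdivision_def)
  from polygon_length_le_path_length[OF this, of X g] show ?thesis
    by (simp add: polygon_length_def)
qed

text \<open>Concatenate a subdivision of \<open>{a..c}\<close> with one of \<open>{c..b}\<close>. Neither need contain \<open>c\<close>, but the
  extra segment that joins them only adds to the length.\<close>

lemma path_length_join_le:
  assumes "a \<le> c" "c \<le> b"
  shows "path_length X g a c + path_length X g c b \<le> path_length X g a b"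
proof -
  have main: "ennreal (polygon_length X g s m) + ennreal (polygon_length X g t n)
      \<le> path_length X g a b"
    if s: "subdivision a c m s" and t: "subdivision c b n t" for m s n t
  proof -
    define r where "r = (\<lambda>i. if i \<le> m then s i else t (i - Suc m))"
    have "subdivision a b (Suc m + n) r"
      unfolding subdivision_def
    proof (intro conjI allI impI)
      fix i assume "i \<le> Suc m + n"
      then have "i \<le> m \<or> (m < i \<and> i - Suc m \<le> n)" by auto
      then show "r i \<in> {a..b}"
        using s t assms unfolding subdivision_def r_def by fastforce
    next
      fix i assume i: "i < Suc m + n"
      consider "i < m" | "i = m" | "m < i" "i - Suc m < n" "Suc i - Suc m = Suc (i - Suc m)"
        using i by fastforce
      then show "r i \<le> r (Suc i)"
      proof cases
        case 2
        then have "r i \<le> c" "c \<le> r (Suc i)" using s t by (auto simp: subdivision_def r_def)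
        then show ?thesis by simp
      qed (use s t in \<open>auto simp: subdivision_def r_def\<close>)
    qed
    moreover have "polygon_length X g s m + polygon_length X g t n
        \<le> polygon_length X g r (Suc m + n)"
    proof -
      have "polygon_length X g r (Suc m + n) =
          (\<Sum>i<Suc m. mdist X (g (r i)) (g (r (Suc i)))) +
          (\<Sum>i<n. mdist X (g (r (Suc m + i))) (g (r (Suc (Suc m + i)))))"
        unfolding polygon_length_def by (induction n) auto
      moreover have "(\<Sum>i<Suc m. mdist X (g (r i)) (g (r (Suc i)))) \<ge> polygon_length X g s m"
        by (simp add: polygon_length_def r_def)
      ultimately show ?thesis by (simp add: polygon_length_def r_def)
    qed
    ultimately show ?thesis
      using polygon_length_le_path_length[of a b "Suc m + n" r X g]
      by (simp add: polygon_length_nonneg flip: ennreal_plus)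
        (meson ennreal_leI order_trans)
  qed
  have fix_s: "ennreal (polygon_length X g s m) + path_length X g c b \<le> path_length X g a b"
    if s: "subdivision a c m s" for m s
  proof -
    have "subdivision c b 0 (\<lambda>_. c)" using assms by (simp add: subdivision_def)
    then have "{(n, t). subdivision c b n t} \<noteq> {}" by blast
    then have "ennreal (polygon_length X g s m) + path_length X g c b =
        (SUP x \<in> {(n, t). subdivision c b n t}.
           ennreal (polygon_length X g s m) + (case x of (n, t) \<Rightarrow> ennreal (polygon_length X g t n)))"
      unfolding path_length_eq_SUP by (subst ennreal_SUP_add_right) auto
    also have "\<dots> \<le> path_length X g a b"
      by (rule SUP_least) (use main[OF s] in auto)
    finally show ?thesis .
  qed
  have "subdivision a c 0 (\<lambda>_. c)" using assms by (simp add: subdivision_def)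
  then have "{(n, t). subdivision a c n t} \<noteq> {}" by blast
  then have "path_length X g c b + path_length X g a c =
      (SUP x \<in> {(n, t). subdivision a c n t}.
         path_length X g c b + (case x of (n, t) \<Rightarrow> ennreal (polygon_length X g t n)))"
    by (subst path_length_eq_SUP[of X g a c], subst ennreal_SUP_add_right) auto
  also have "\<dots> \<le> path_length X g a b"
    by (rule SUP_least) (use fix_s in \<open>auto simp: add.commute\<close>)
  finally show ?thesis by (simp add: add.commute)
qed

text \<open>Cutting a subdivision at \<open>c\<close> by clamping its points to the two halves can only lengthen the
  polygon: at most one segment straddles \<open>c\<close>, and it is handled by the triangle inequality.\<close>

lemma path_length_split_le:
  assumes "a \<le> c" "c \<le> b" and g: "g \<in> {a..b} \<rightarrow> mspace X"
  shows "path_length X g a b \<le> path_length X g a c + path_length X g c b"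
proof (rule path_length_least)
  fix n t assume t: "subdivision a b n t"
  have "subdivision a c n (\<lambda>i. min (t i) c)" "subdivision c b n (\<lambda>i. max (t i) c)"
    using t assms(1,2) by (auto intro: subdivision_min subdivision_max)
  then have *: "ennreal (polygon_length X g (\<lambda>i. min (t i) c) n) \<le> path_length X g a c"
    "ennreal (polygon_length X g (\<lambda>i. max (t i) c) n) \<le> path_length X g c b"
    by (simp_all add: polygon_length_le_path_length)
  have "polygon_length X g t n
      \<le> polygon_length X g (\<lambda>i. min (t i) c) n + polygon_length X g (\<lambda>i. max (t i) c) n"
    unfolding polygon_length_def sum.distrib[symmetric]
  proof (rule sum_mono)
    fix i assume "i \<in> {..<n}"
    then have i: "t i \<in> {a..b}" "t (Suc i) \<in> {a..b}" "t i \<le> t (Suc i)"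
      using t by (auto simp: subdivision_def)
    have "mdist X (g (t i)) (g (t (Suc i))) \<le> mdist X (g (t i)) (g c) + mdist X (g c) (g (t (Suc i)))"
      using g i assms(1,2) by (intro mdist_triangle) auto
    then show "mdist X (g (t i)) (g (t (Suc i))) \<le>
        mdist X (g (min (t i) c)) (g (min (t (Suc i)) c)) +
        mdist X (g (max (t i) c)) (g (max (t (Suc i)) c))"
      using i by (auto simp: min_def max_def)
  qed
  then have "ennreal (polygon_length X g t n)
      \<le> ennreal (polygon_length X g (\<lambda>i. min (t i) c) n)
        + ennreal (polygon_length X g (\<lambda>i. max (t i) c) n)"
    by (simp add: polygon_length_nonneg flip: ennreal_plus)
  also have "\<dots> \<le> path_length X g a c + path_length X g c b"
    using * by (rule add_mono)
  finally show "ennreal (polygon_length X g t n) \<le> path_length X g a c + path_length X g c b" .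
qed

lemma path_length_add:
  assumes "a \<le> c" "c \<le> b" and "g \<in> {a..b} \<rightarrow> mspace X"
  shows "path_length X g a c + path_length X g c b = path_length X g a b"
  using path_length_join_le path_length_split_le assms by (metis order_antisym)

lemma curve_between_mspace: "curve_between X g a b x y \<Longrightarrow> g \<in> {a..b} \<rightarrow> mspace X"
  unfolding curve_between_def using continuous_map_image_subset_topspace by fastforce

lemma continuous_on_polygon_length:
  assumes g: "continuous_map (top_of_set {a..b}) (mtopology_of X) g"
    and \<tau>: "\<And>i. i \<le> n \<Longrightarrow> continuous_on {a..b} (\<lambda>r. \<tau> r i)"
    and \<tau>_in: "\<And>i r. i \<le> n \<Longrightarrow> r \<in> {a..b} \<Longrightarrow> \<tau> r i \<in> {a..b}"
  shows "continuous_on {a..b} (\<lambda>r. polygon_length X g (\<tau> r) n)"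
proof -
  have g\<tau>: "continuous_map (top_of_set {a..b}) (mtopology_of X) (\<lambda>r. g (\<tau> r i))" if "i \<le> n" for i
  proof -
    have "continuous_map (top_of_set {a..b}) (top_of_set {a..b}) (\<lambda>r. \<tau> r i)"
      using \<tau>[OF that] \<tau>_in[OF that] by (auto simp: continuous_map_in_subtopology)
    from continuous_map_compose[OF this g] show ?thesis by (simp add: o_def)
  qed
  have "continuous_map (top_of_set {a..b}) euclideanreal
      (\<lambda>r. mdist X (g (\<tau> r i)) (g (\<tau> r (Suc i))))" if "i < n" for i
    using g\<tau>[of i] g\<tau>[of "Suc i"] that by (intro continuous_map_mdist) auto
  then show ?thesis
    unfolding polygon_length_def by (intro continuous_on_sum) simp
qed

text \<open>Length is lower semicontinuous in the endpoints, because it is a supremum of polygon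
  lengths, and a polygon length varies continuously when the subdivision points are clamped to an
  interval with moving endpoints.\<close>

lemma path_length_lower_semicontinuous:
  assumes g: "continuous_map (top_of_set {a..b}) (mtopology_of X) g"
    and S: "continuous_on {a..b} S" and T: "continuous_on {a..b} T"
    and ST: "\<And>r. r \<in> {a..b} \<Longrightarrow> a \<le> S r \<and> S r \<le> T r \<and> T r \<le> b"
    and t: "t \<in> {a..b}" and k: "k < path_length X g (S t) (T t)"
  shows "\<forall>\<^sub>F r in at t within {a..b}. k < path_length X g (S r) (T r)"
proof -
  obtain n \<tau> where \<tau>: "subdivision (S t) (T t) n \<tau>" "k < ennreal (polygon_length X g \<tau> n)"
    using k by (rule less_path_lengthE)
  let ?clamp = "\<lambda>r i. max (S r) (min (T r) (\<tau> i))"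
  let ?P = "\<lambda>r. polygon_length X g (?clamp r) n"
  have "continuous_on {a..b} ?P"
  proof (rule continuous_on_polygon_length[OF g])
    show "continuous_on {a..b} (\<lambda>r. ?clamp r i)" for i
      by (intro continuous_intros S T)
    show "?clamp r i \<in> {a..b}" if "r \<in> {a..b}" for i r
      using ST[OF that] by (auto simp: max_def min_def)
  qed
  then have "((\<lambda>r. ennreal (?P r)) \<longlongrightarrow> ennreal (?P t)) (at t within {a..b})"
    using t by (intro tendsto_ennrealI) (simp add: continuous_on_def)
  moreover have "?P t = polygon_length X g \<tau> n"
    using \<tau>(1) by (auto simp: polygon_length_def subdivision_def intro!: sum.cong)
  ultimately have "\<forall>\<^sub>F r in at t within {a..b}. k < ennreal (?P r)"
    using \<tau>(2) by (intro order_tendstoD(1)) auto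
  moreover have "\<forall>\<^sub>F r in at t within {a..b}. r \<in> {a..b}"
    by (simp add: eventually_at_filter)
  ultimately show ?thesis
  proof eventually_elim
    case (elim r)
    have "subdivision (S r) (T r) n (?clamp r)"
      using \<tau>(1) ST[OF elim(2)] by (intro subdivision_clamp) auto
    from polygon_length_le_path_length[OF this] elim(1) show ?case
      by (rule less_le_trans[rotated])
  qed
qed

text \<open>By additivity, lower semicontinuity of the length of \<open>g\<close> on \<open>{t..b}\<close> is upper semicontinuity
  of its length on \<open>{a..t}\<close>.\<close>

lemma continuous_on_arclength:
  assumes ab: "a \<le> b" and g: "continuous_map (top_of_set {a..b}) (mtopology_of X) g"
    and fin: "path_length X g a b < \<infinity>"
  shows "continuous_on {a..b} (\<lambda>t. enn2real (path_length X g a t))"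
proof -
  have gX: "g \<in> {a..b} \<rightarrow> mspace X"
    using g continuous_map_image_subset_topspace by fastforce
  have add: "path_length X g a t + path_length X g t b = path_length X g a b"
    if "t \<in> {a..b}" for t
    using that gX by (intro path_length_add) auto
  have fin1: "path_length X g a t < \<infinity>" "path_length X g t b < \<infinity>" if "t \<in> {a..b}" for t
    using add[OF that] fin by (auto simp: top_unique less_top[symmetric])
  define V W where "V = (\<lambda>t. enn2real (path_length X g a t))"
    and "W = (\<lambda>t. enn2real (path_length X g t b))"
  have VW: "V t + W t = enn2real (path_length X g a b)" if "t \<in> {a..b}" for t
    using fin1[OF that] unfolding V_def W_def add[OF that, symmetric]
    by (simp add: enn2real_plus less_top)
  have eV: "path_length X g a t = ennreal (V t)" "path_length X g t b = ennreal (W t)"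
    if "t \<in> {a..b}" for t
    using fin1[OF that] by (simp_all add: V_def W_def less_top)
  have nn: "0 \<le> V t" "0 \<le> W t" for t by (simp_all add: V_def W_def)
  have near: "\<forall>\<^sub>F r in at t within {a..b}. r \<in> {a..b}" for t
    by (simp add: eventually_at_filter)
  have lscV: "\<forall>\<^sub>F r in at t within {a..b}. c < V r" if t: "t \<in> {a..b}" and c: "c < V t" for t c
  proof (cases "0 \<le> c")
    case False
    then have "c < V r" for r using nn[of r] by linarith
    then show ?thesis by simp
  next
    case True
    then have "ennreal c < path_length X g a t" using c t by (simp add: eV ennreal_less_iff)
    then have "\<forall>\<^sub>F r in at t within {a..b}. ennreal c < path_length X g a r"
      using t by (intro path_length_lower_semicontinuous[OF g]) auto
    with near show ?thesis
      by eventually_elim (use True in \<open>simp add: eV ennreal_less_iff\<close>)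
  qed
  have lscW: "\<forall>\<^sub>F r in at t within {a..b}. c < W r" if t: "t \<in> {a..b}" and c: "c < W t" for t c
  proof (cases "0 \<le> c")
    case False
    then have "c < W r" for r using nn[of r] by linarith
    then show ?thesis by simp
  next
    case True
    then have "ennreal c < path_length X g t b" using c t by (simp add: eV ennreal_less_iff)
    then have "\<forall>\<^sub>F r in at t within {a..b}. ennreal c < path_length X g r b"
      using t by (intro path_length_lower_semicontinuous[OF g]) auto
    with near show ?thesis
      by eventually_elim (use True in \<open>simp add: eV ennreal_less_iff\<close>)
  qed
  have "continuous_on {a..b} V"
    unfolding continuous_on_def
  proof (intro ballI order_tendstoI)
    fix t c assume t: "t \<in> {a..b}"
    show "\<forall>\<^sub>F r in at t within {a..b}. c < V r" if "c < V t"
      using lscV[OF t that] .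
    show "\<forall>\<^sub>F r in at t within {a..b}. V r < c" if "V t < c"
    proof -
      have "enn2real (path_length X g a b) - c < W t" using VW[OF t] that by simp
      from lscW[OF t this] have "\<forall>\<^sub>F r in at t within {a..b}. enn2real (path_length X g a b) - c < W r" .
      with near show ?thesis
      proof eventually_elim
        case (elim r)
        then show ?case using VW[of r] by simp
      qed
    qed
  qed
  then show ?thesis by (simp add: V_def)
qed


section \<open>Arc length parametrization\<close>

text \<open>Arc length is continuous and starts at \<open>0\<close>, so by the intermediate value theorem it takes
  every value up to the total length. This makes the choice operator in the arc length
  parametrization meaningful.\<close>

lemma arclength_paramE:
  assumes "curve_between X g a b x y" "rectifiable X g a b"
    and u: "u \<in> {0..enn2real (path_length X g a b)}"
  obtains t where "t \<in> {a..b}" "path_length X g a t = ennreal u"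
    "arclength_param X g a b u = g t"
proof -
  let ?V = "\<lambda>t. enn2real (path_length X g a t)"
  have ab: "a \<le> b" and g: "continuous_map (top_of_set {a..b}) (mtopology_of X) g"
    using assms(1) by (auto simp: curve_between_def)
  have fin: "path_length X g a b < \<infinity>" using assms(2) by (simp add: rectifiable_def)
  have gX: "g \<in> {a..b} \<rightarrow> mspace X" using curve_between_mspace[OF assms(1)] .
  have "path_length X g a a = 0"
  proof -
    have "path_length X g a a \<le> ennreal 0"
    proof (rule path_length_least)
      fix n t assume "subdivision a a n t"
      then have "t i = a" if "i \<le> n" for i using that by (auto simp: subdivision_def)
      then show "ennreal (polygon_length X g t n) \<le> ennreal 0"
        using Pi_mem[OF gX, of a] ab by (auto simp: polygon_length_def intro!: sum_nonpos)
    qed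
    then show ?thesis by simp
  qed
  then have "\<exists>t\<ge>a. t \<le> b \<and> ?V t = u"
    using u ab continuous_on_arclength[OF ab g fin] by (intro IVT') auto
  then obtain t where t: "t \<in> {a..b}" "?V t = u" by auto
  have "path_length X g a t < \<infinity>"
    using path_length_add[of a t b g X] t(1) gX fin by (auto simp: less_top[symmetric])
  then have "path_length X g a t = ennreal u"
    using t(2) by (auto simp: less_top)
  then have "\<exists>t. t \<in> {a..b} \<and> path_length X g a t = ennreal u" using t(1) by blast
  from someI_ex[OF this] show thesis
    by (intro that) (auto simp: arclength_param_def)
qed

lemma arclength_param_mspace:
  assumes "curve_between X g a b x y" "rectifiable X g a b"
    and "u \<in> {0..enn2real (path_length X g a b)}"
  shows "arclength_param X g a b u \<in> mspace X"
proof -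
  obtain t where "t \<in> {a..b}" "arclength_param X g a b u = g t"
    using arclength_paramE[OF assms] .
  then show ?thesis using Pi_mem[OF curve_between_mspace[OF assms(1)], of t] by simp
qed

lemma arclength_param_nonexpanding:
  assumes g: "curve_between X g a b x y" "rectifiable X g a b"
    and "u \<in> {0..enn2real (path_length X g a b)}" "v \<in> {0..enn2real (path_length X g a b)}"
  shows "mdist X (arclength_param X g a b u) (arclength_param X g a b v) \<le> \<bar>u - v\<bar>"
proof -
  have gX: "g \<in> {a..b} \<rightarrow> mspace X" using curve_between_mspace[OF g(1)] .
  have le: "mdist X (g s) (g t) \<le> v - u"
    if s: "s \<in> {a..b}" "path_length X g a s = ennreal u" "0 \<le> u"
      and t: "t \<in> {a..b}" "path_length X g a t = ennreal v" "0 \<le> v" and "s \<le> t" for s t u v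
  proof -
    have "path_length X g a s + path_length X g s t = path_length X g a t"
      using s t \<open>s \<le> t\<close> gX by (intro path_length_add) auto
    then have "ennreal u + ennreal (mdist X (g s) (g t)) \<le> ennreal v"
      using mdist_le_path_length[OF \<open>s \<le> t\<close>, of X g] s(2) t(2) by (metis add_left_mono)
    then show ?thesis using s(3) t(3) by (simp flip: ennreal_plus)
  qed
  obtain s where s: "s \<in> {a..b}" "path_length X g a s = ennreal u" "arclength_param X g a b u = g s"
    using arclength_paramE[OF g assms(3)] .
  obtain t where t: "t \<in> {a..b}" "path_length X g a t = ennreal v" "arclength_param X g a b v = g t"
    using arclength_paramE[OF g assms(4)] .
  show ?thesis
    using le[of s u t v] le[of t v s u] s t assms(3,4) mdist_commute[of X "g s" "g t"]
    by (cases "s \<le> t") auto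
qed

lemma arclength_param_endpoints:
  assumes g: "curve_between X g a b x y" "rectifiable X g a b"
  shows "arclength_param X g a b 0 = x"
    and "arclength_param X g a b (enn2real (path_length X g a b)) = y"
proof -
  have gX: "g \<in> {a..b} \<rightarrow> mspace X" using curve_between_mspace[OF g(1)] .
  have ab: "a \<le> b" "g a = x" "g b = y" using g(1) by (auto simp: curve_between_def)
  have fin: "path_length X g a b < \<infinity>" using g(2) by (simp add: rectifiable_def)
  obtain s where s: "s \<in> {a..b}" "path_length X g a s = ennreal 0" "arclength_param X g a b 0 = g s"
    using arclength_paramE[OF g, of 0] by auto
  have "mdist X (g a) (g s) = 0"
    using mdist_le_path_length[of a s X g] s by simp
  then show "arclength_param X g a b 0 = x" using s ab Pi_mem[OF gX, of a] Pi_mem[OF gX, of s] by auto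
  obtain t where t: "t \<in> {a..b}" "path_length X g a t = ennreal (enn2real (path_length X g a b))"
    "arclength_param X g a b (enn2real (path_length X g a b)) = g t"
    using arclength_paramE[OF g, of "enn2real (path_length X g a b)"] by auto
  then have "path_length X g a b + path_length X g t b = path_length X g a b + 0"
    using path_length_add[of a t b g X] gX fin by (simp add: less_top)
  then have "path_length X g t b = 0"
    using fin by (subst (asm) ennreal_add_left_cancel) auto
  then have "mdist X (g t) (g b) = 0"
    using mdist_le_path_length[of t b X g] t by simp
  then show "arclength_param X g a b (enn2real (path_length X g a b)) = y"
    using t ab Pi_mem[OF gX, of b] Pi_mem[OF gX, of t] by auto
qed


section \<open>The conformal distance\<close>

lemma arc_between_imp_curve_between: "arc_between X g a b x y \<Longrightarrow> curve_between X g a b x y"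
  unfolding arc_between_def curve_between_def embedding_map_def
  by (auto dest!: homeomorphic_imp_continuous_map simp: continuous_map_in_subtopology)

lemma intrinsic_short_arc:
  assumes "intrinsic X" "x \<in> mspace X" "y \<in> mspace X" "0 < e"
  obtains g a b where "short_arc X e g a b x y"
proof -
  have "ennreal (mdist X x y) < ennreal (mdist X x y + e)"
    using assms(4) by (simp add: ennreal_less_iff)
  then have "(INF (g, a, b) \<in> {(g, a, b). arc_between X g a b x y}. path_length X g a b)
      < ennreal (mdist X x y + e)"
    using assms(1-3) by (simp add: intrinsic_def)
  then show thesis
    using that unfolding INF_less_iff short_arc_def by (auto intro: less_imp_le)
qed

lemma short_arc_curve:
  assumes "short_arc X h g a b x y" "0 \<le> h"
  shows "curve_between X g a b x y" "rectifiable X g a b"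
    "enn2real (path_length X g a b) \<le> mdist X x y + h"
proof -
  have le: "path_length X g a b \<le> ennreal (mdist X x y + h)"
    and arc: "arc_between X g a b x y"
    using assms by (auto simp: short_arc_def)
  show "curve_between X g a b x y" using arc by (rule arc_between_imp_curve_between)
  show "rectifiable X g a b"
    unfolding rectifiable_def using le by (simp add: le_less_trans[OF le])
  show "enn2real (path_length X g a b) \<le> mdist X x y + h"
    using assms(2) by (intro enn2real_leI[OF _ le] add_nonneg_nonneg mdist_nonneg)
qed

lemma mdist_le_arclength:
  assumes g: "curve_between X g a b x y" "rectifiable X g a b"
  shows "mdist X x y \<le> enn2real (path_length X g a b)"
  using arclength_param_nonexpanding[OF g, of 0 "enn2real (path_length X g a b)"]
  by (simp add: arclength_param_endpoints[OF g])

lemma mdist_arclength_param_le: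
  assumes g: "curve_between X g a b x y" "rectifiable X g a b"
    and u: "u \<in> {0..enn2real (path_length X g a b)}"
  shows "mdist X x (arclength_param X g a b u) \<le> u"
    and "mdist X y (arclength_param X g a b u) \<le> enn2real (path_length X g a b) - u"
  using arclength_param_nonexpanding[OF g, of 0 u] u
    arclength_param_nonexpanding[OF g, of "enn2real (path_length X g a b)" u]
  by (simp_all add: arclength_param_endpoints[OF g])

lemma continuous_on_conformal_density_arclength:
  assumes g: "curve_between X g a b x y" "rectifiable X g a b" and p: "p \<in> mspace X"
  shows "continuous_on {0..enn2real (path_length X g a b)}
           (\<lambda>u. conformal_density X p \<epsilon> (arclength_param X g a b u))"
proof -
  let ?\<beta> = "arclength_param X g a b" and ?I = "{0..enn2real (path_length X g a b)}"
  have "1-lipschitz_on ?I (\<lambda>u. mdist X (?\<beta> u) p)"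
  proof (rule lipschitz_onI)
    fix u v assume uv: "u \<in> ?I" "v \<in> ?I"
    have "mdist X (?\<beta> u) (?\<beta> v) \<le> \<bar>u - v\<bar>"
      using arclength_param_nonexpanding[OF g uv] .
    moreover have "mdist X (?\<beta> u) p \<le> mdist X (?\<beta> u) (?\<beta> v) + mdist X (?\<beta> v) p"
      "mdist X (?\<beta> v) p \<le> mdist X (?\<beta> v) (?\<beta> u) + mdist X (?\<beta> u) p"
      using arclength_param_mspace[OF g] uv p by (auto intro!: mdist_triangle)
    ultimately show "dist (mdist X (?\<beta> u) p) (mdist X (?\<beta> v) p) \<le> 1 * dist u v"
      by (simp add: dist_real_def mdist_commute[of X "?\<beta> v" "?\<beta> u"])
  qed simp
  then show ?thesis
    unfolding conformal_density_def
    by (intro continuous_intros lipschitz_on_continuous_on)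
qed

lemma line_integral_conformal_density_nonneg:
  assumes g: "curve_between X g a b x y" "rectifiable X g a b" and p: "p \<in> mspace X"
  shows "0 \<le> line_integral X (conformal_density X p \<epsilon>) g a b"
  unfolding line_integral_def
  using continuous_on_conformal_density_arclength[OF g p]
  by (intro Henstock_Kurzweil_Integration.integral_nonneg integrable_continuous_real)
    (auto simp: conformal_density_def)

lemma conformal_dist_le_line_integral:
  assumes g: "curve_between X g a b x y" "rectifiable X g a b"
    and xy: "x \<in> mspace X" "y \<in> mspace X" and p: "p \<in> mspace X"
  shows "conformal_dist X p \<epsilon> x y \<le> line_integral X (conformal_density X p \<epsilon>) g a b"
proof -
  have "bdd_below {line_integral X (conformal_density X p \<epsilon>) g a b |g a b.
      curve_between X g a b x y \<and> rectifiable X g a b}"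
    using line_integral_conformal_density_nonneg[OF _ _ p] by (intro bdd_belowI[of _ 0]) auto
  then show ?thesis
    unfolding conformal_dist_def using xy g by (auto intro!: cInf_lower)
qed

lemma conformal_dist_greatest:
  assumes "intrinsic X" "x \<in> mspace X" "y \<in> mspace X"
    and "\<And>g a b. curve_between X g a b x y \<Longrightarrow> rectifiable X g a b
           \<Longrightarrow> c \<le> line_integral X (conformal_density X p \<epsilon>) g a b"
  shows "c \<le> conformal_dist X p \<epsilon> x y"
proof -
  obtain g a b where "short_arc X 1 g a b x y"
    using intrinsic_short_arc[OF assms(1-3), of 1] by auto
  then have "curve_between X g a b x y" "rectifiable X g a b"
    by (auto dest: short_arc_curve)
  then show ?thesis
    unfolding conformal_dist_def using assms(2-4) by (auto intro!: cInf_greatest)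
qed

text \<open>The density is at most \<open>1\<close>, so the conformal length of a curve is at most its length.\<close>

lemma conformal_dist_le_mdist:
  assumes X: "intrinsic X" and xy: "x \<in> mspace X" "y \<in> mspace X" and p: "p \<in> mspace X"
    and "0 \<le> \<epsilon>"
  shows "conformal_dist X p \<epsilon> x y \<le> mdist X x y"
proof (rule field_le_epsilon)
  fix e :: real assume "0 < e"
  then obtain g a b where "short_arc X e g a b x y"
    using intrinsic_short_arc[OF X xy] by blast
  then have g: "curve_between X g a b x y" "rectifiable X g a b"
    and L: "enn2real (path_length X g a b) \<le> mdist X x y + e"
    using short_arc_curve \<open>0 < e\<close> by (metis less_imp_le)+
  have "conformal_dist X p \<epsilon> x y \<le> line_integral X (conformal_density X p \<epsilon>) g a b"
    using g xy p by (rule conformal_dist_le_line_integral)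
  also have "\<dots> \<le> integral {0..enn2real (path_length X g a b)} (\<lambda>_. 1)"
    unfolding line_integral_def
    using continuous_on_conformal_density_arclength[OF g p] \<open>0 \<le> \<epsilon>\<close>
    by (intro integral_le integrable_continuous_real) (auto simp: conformal_density_def)
  also have "\<dots> \<le> mdist X x y + e" using L by simp
  finally show "conformal_dist X p \<epsilon> x y \<le> mdist X x y + e" .
qed


section \<open>Upper bound for the conformal distance\<close>

lemma integral_exp_abs_le:
  assumes "0 < \<epsilon>" "0 \<le> c" "c \<le> (L::real)"
  shows "integral {0..L} (\<lambda>u. exp (- \<epsilon> * \<bar>u - c\<bar>)) \<le> 2 / \<epsilon>"
proof -
  have "((\<lambda>u. exp (\<epsilon> * (u - c))) has_integral exp (\<epsilon> * (c - c)) / \<epsilon> - exp (\<epsilon> * (0 - c)) / \<epsilon>) {0..c}"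
    using assms by (intro fundamental_theorem_of_calculus)
      (auto intro!: derivative_eq_intros simp flip: has_real_derivative_iff_has_vector_derivative)
  then have 1: "((\<lambda>u. exp (- \<epsilon> * \<bar>u - c\<bar>)) has_integral (1 - exp (- \<epsilon> * c)) / \<epsilon>) {0..c}"
    by (rule has_integral_eq[rotated, THEN has_integral_eq_rhs])
      (auto simp: diff_divide_distrib algebra_simps)
  have "((\<lambda>u. exp (- \<epsilon> * (u - c))) has_integral
      - exp (- \<epsilon> * (L - c)) / \<epsilon> - (- exp (- \<epsilon> * (c - c)) / \<epsilon>)) {c..L}"
    using assms by (intro fundamental_theorem_of_calculus)
      (auto intro!: derivative_eq_intros simp flip: has_real_derivative_iff_has_vector_derivative)
  then have 2: "((\<lambda>u. exp (- \<epsilon> * \<bar>u - c\<bar>)) has_integral (1 - exp (- \<epsilon> * (L - c))) / \<epsilon>) {c..L}"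
    by (rule has_integral_eq[rotated, THEN has_integral_eq_rhs])
      (auto simp: diff_divide_distrib)
  have "integral {0..L} (\<lambda>u. exp (- \<epsilon> * \<bar>u - c\<bar>)) =
      (1 - exp (- \<epsilon> * c)) / \<epsilon> + (1 - exp (- \<epsilon> * (L - c))) / \<epsilon>"
    using has_integral_combine[OF assms(2,3) 1 2] by (rule integral_unique)
  also have "\<dots> \<le> 1 / \<epsilon> + 1 / \<epsilon>"
    using assms(1) by (intro add_mono divide_right_mono) auto
  finally show ?thesis by simp
qed

lemma gromov_product_endpoint_bounds:
  assumes "x \<in> mspace X" "y \<in> mspace X" "p \<in> mspace X"
  shows "0 \<le> gromov_product X x y p" "gromov_product X x y p \<le> mdist X x y"
proof -
  have "mdist X y p \<le> mdist X y x + mdist X x p" "mdist X x p \<le> mdist X x y + mdist X y p"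
    using assms by (auto intro: mdist_triangle)
  then show "0 \<le> gromov_product X x y p" "gromov_product X x y p \<le> mdist X x y"
    using mdist_commute[of X x y] mdist_commute[of X x p]
    by (auto simp: gromov_product_def)
qed

text \<open>Along a nearly shortest curve from \<open>x\<close> to \<open>y\<close> the distance to \<open>p\<close> grows with slope
  \<open>1\<close> away from the parameter \<open>(y|p)\<^sub>x\<close>: the triangle inequality at \<open>x\<close> controls one side, the one
  at \<open>y\<close> the other. Hence the integral of \<open>exp (- \<epsilon> * |w - p|)\<close> over the points \<open>w\<close> of the curve is
  bounded independently of its length.\<close>

lemma mdist_short_curve_ge:
  assumes g: "curve_between X g a b x y" "rectifiable X g a b"
    and L: "enn2real (path_length X g a b) \<le> mdist X x y + h"
    and u: "u \<in> {0..enn2real (path_length X g a b)}"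
    and xy: "x \<in> mspace X" "y \<in> mspace X" and p: "p \<in> mspace X" and "0 \<le> h"
  shows "gromov_product X p x y + \<bar>u - gromov_product X x y p\<bar> - h
           \<le> mdist X (arclength_param X g a b u) p"
proof -
  let ?w = "arclength_param X g a b u"
  have w: "?w \<in> mspace X" using arclength_param_mspace[OF g u] .
  have "mdist X x p \<le> mdist X x ?w + mdist X ?w p" "mdist X y p \<le> mdist X y ?w + mdist X ?w p"
    using xy p w by (auto intro: mdist_triangle)
  then show ?thesis
    using mdist_arclength_param_le[OF g u] L \<open>0 \<le> h\<close>
      mdist_commute[of X x y] mdist_commute[of X x p]
    by (auto simp: gromov_product_def abs_if field_simps)
qed

lemma conformal_dist_le_exp_gromov_product:
  assumes X: "intrinsic X" and xy: "x \<in> mspace X" "y \<in> mspace X" and p: "p \<in> mspace X"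
    and \<epsilon>: "0 < \<epsilon>"
  shows "conformal_dist X p \<epsilon> x y \<le> (2 * exp \<epsilon> / \<epsilon>) * exp (- \<epsilon> * gromov_product X p x y)"
proof -
  obtain g a b where "short_arc X 1 g a b x y"
    using intrinsic_short_arc[OF X xy, of 1] by auto
  then have g: "curve_between X g a b x y" "rectifiable X g a b"
    and L: "enn2real (path_length X g a b) \<le> mdist X x y + 1"
    by (auto dest: short_arc_curve)
  let ?I = "{0..enn2real (path_length X g a b)}" and ?P = "gromov_product X p x y"
  let ?c = "gromov_product X x y p"
  have c: "0 \<le> ?c" "?c \<le> enn2real (path_length X g a b)"
    using gromov_product_endpoint_bounds[OF xy p] mdist_le_arclength[OF g] by auto
  have "conformal_dist X p \<epsilon> x y \<le> line_integral X (conformal_density X p \<epsilon>) g a b"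
    using g xy p by (rule conformal_dist_le_line_integral)
  also have "\<dots> \<le> integral ?I (\<lambda>u. exp \<epsilon> * exp (- \<epsilon> * ?P) * exp (- \<epsilon> * \<bar>u - ?c\<bar>))"
    unfolding line_integral_def
  proof (intro integral_le integrable_continuous_real)
    show "continuous_on ?I (\<lambda>u. conformal_density X p \<epsilon> (arclength_param X g a b u))"
      using g p by (rule continuous_on_conformal_density_arclength)
    show "continuous_on ?I (\<lambda>u. exp \<epsilon> * exp (- \<epsilon> * ?P) * exp (- \<epsilon> * \<bar>u - ?c\<bar>))"
      by (intro continuous_intros)
    fix u assume "u \<in> ?I"
    from mdist_short_curve_ge[OF g L this xy p]
    have "\<epsilon> * (?P + \<bar>u - ?c\<bar> - 1) \<le> \<epsilon> * mdist X (arclength_param X g a b u) p"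
      using \<epsilon> by (intro mult_left_mono) auto
    then show "conformal_density X p \<epsilon> (arclength_param X g a b u)
        \<le> exp \<epsilon> * exp (- \<epsilon> * ?P) * exp (- \<epsilon> * \<bar>u - ?c\<bar>)"
      unfolding conformal_density_def exp_add[symmetric] by (simp add: algebra_simps)
  qed
  also have "\<dots> = exp \<epsilon> * exp (- \<epsilon> * ?P) * integral ?I (\<lambda>u. exp (- \<epsilon> * \<bar>u - ?c\<bar>))"
    by simp
  also have "\<dots> \<le> exp \<epsilon> * exp (- \<epsilon> * ?P) * (2 / \<epsilon>)"
    using integral_exp_abs_le[OF \<epsilon> c] by (intro mult_left_mono) auto
  finally show ?thesis by (simp add: mult_ac)
qed


section \<open>Lower bound for the conformal distance\<close>

text \<open>In a hyperbolic space the distance of the point at parameter \<open>(y|p)\<^sub>x\<close> to \<open>p\<close> is, up to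
  a constant, also at most \<open>(x|y)\<^sub>p\<close>. This is the four-point condition for \<open>x\<close>, \<open>y\<close>, \<open>p\<close> with
  this point as base point; the two terms of its minimum correspond to the two pieces of the
  curve.\<close>

lemma mdist_short_curve_centre_le:
  assumes X: "hyperbolic_space \<delta> X"
    and g: "curve_between X g a b x y" "rectifiable X g a b"
    and L: "enn2real (path_length X g a b) \<le> mdist X x y + h"
    and xy: "x \<in> mspace X" "y \<in> mspace X" and p: "p \<in> mspace X" and "0 \<le> h"
  shows "mdist X (arclength_param X g a b (gromov_product X x y p)) p
           \<le> gromov_product X p x y + 2 * \<delta> + h"
proof -
  let ?c = "gromov_product X x y p"
  let ?w = "arclength_param X g a b ?c"
  have c: "?c \<in> {0..enn2real (path_length X g a b)}"
    using gromov_product_endpoint_bounds[OF xy p] mdist_le_arclength[OF g] by auto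
  have w: "?w \<in> mspace X" using arclength_param_mspace[OF g c] .
  have "min (gromov_product X ?w x p) (gromov_product X ?w p y) - \<delta> \<le> gromov_product X ?w x y"
    using X xy p w unfolding hyperbolic_space_def by blast
  then show ?thesis
    using mdist_arclength_param_le[OF g c] L \<open>0 \<le> h\<close>
      mdist_commute[of X x y] mdist_commute[of X x p] mdist_commute[of X y p]
      mdist_commute[of X ?w p]
    unfolding gromov_product_def[of X ?w] gromov_product_def[of X p]
    unfolding gromov_product_def[of X x y p]
    by (auto simp: min_def field_simps split: if_splits)
qed

text \<open>The density is bounded below near the point at parameter \<open>(y|p)\<^sub>x\<close>. The curve may end
  there, so that a one-sided interval has to do, and it may be short, which causes the factor
  \<open>min 1 |x - y|\<close>.\<close>

lemma line_integral_short_curve_ge: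
  assumes X: "hyperbolic_space \<delta> X"
    and g: "curve_between X g a b x y" "rectifiable X g a b"
    and L: "enn2real (path_length X g a b) \<le> mdist X x y + h"
    and xy: "x \<in> mspace X" "y \<in> mspace X" and p: "p \<in> mspace X" and "0 \<le> h" and \<epsilon>: "0 < \<epsilon>"
  shows "exp (- \<epsilon> * (gromov_product X p x y + 2 * \<delta> + h + 1)) * min 1 (mdist X x y)
           \<le> line_integral X (conformal_density X p \<epsilon>) g a b"
proof -
  let ?c = "gromov_product X x y p" and ?P = "gromov_product X p x y"
  let ?L = "enn2real (path_length X g a b)" and ?\<beta> = "arclength_param X g a b"
  define m where "m = min 1 (mdist X x y)"
  \<comment> \<open>An interval of length \<open>m\<close> within the domain that contains the centre \<open>?c\<close>.\<close>
  define s where "s = min ?c (?L - m)"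
  have c: "?c \<in> {0..?L}"
    using gromov_product_endpoint_bounds[OF xy p] mdist_le_arclength[OF g] by auto
  have m: "0 \<le> m" "m \<le> 1" "m \<le> ?L" using mdist_le_arclength[OF g] by (auto simp: m_def)
  have s: "0 \<le> s" "s \<le> ?c" "?c \<le> s + m" "s + m \<le> ?L" using c m by (auto simp: s_def)
  have int: "(\<lambda>u. conformal_density X p \<epsilon> (?\<beta> u)) integrable_on {0..?L}"
    using continuous_on_conformal_density_arclength[OF g p] by (rule integrable_continuous_real)
  then have int': "(\<lambda>u. conformal_density X p \<epsilon> (?\<beta> u)) integrable_on {s..s + m}"
    using s by (elim integrable_on_subinterval) auto
  have "exp (- \<epsilon> * (?P + 2 * \<delta> + h + 1)) * m =
      integral {s..s + m} (\<lambda>_. exp (- \<epsilon> * (?P + 2 * \<delta> + h + 1)))"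
    using m by simp
  also have "\<dots> \<le> integral {s..s + m} (\<lambda>u. conformal_density X p \<epsilon> (?\<beta> u))"
  proof (rule integral_le[OF _ int'])
    fix u assume u: "u \<in> {s..s + m}"
    then have u': "u \<in> {0..?L}" using s by auto
    have "mdist X (?\<beta> u) p \<le> mdist X (?\<beta> u) (?\<beta> ?c) + mdist X (?\<beta> ?c) p"
      using arclength_param_mspace[OF g] u' c p by (intro mdist_triangle) auto
    also have "\<dots> \<le> 1 + (?P + 2 * \<delta> + h)"
      using arclength_param_nonexpanding[OF g u' c] u s m
        mdist_short_curve_centre_le[OF X g L xy p \<open>0 \<le> h\<close>]
      by (intro add_mono) auto
    finally have "\<epsilon> * mdist X (?\<beta> u) p \<le> \<epsilon> * (?P + 2 * \<delta> + h + 1)"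
      using \<epsilon> by (intro mult_left_mono) auto
    then show "exp (- \<epsilon> * (?P + 2 * \<delta> + h + 1)) \<le> conformal_density X p \<epsilon> (?\<beta> u)"
      by (simp add: conformal_density_def)
  qed (rule integrable_const_ivl)
  also have "\<dots> \<le> line_integral X (conformal_density X p \<epsilon>) g a b"
    unfolding line_integral_def using s int int'
    by (intro integral_subset_le) (auto simp: conformal_density_def)
  finally show ?thesis by (simp add: m_def)
qed

lemma continuous_map_conformal_density:
  assumes "p \<in> mspace X"
  shows "continuous_map (mtopology_of X) euclideanreal (conformal_density X p \<epsilon>)"
proof -
  have "continuous_map (mtopology_of X) euclideanreal (\<lambda>x. mdist X x p)"
    using assms by (intro continuous_map_mdist) auto
  moreover have "continuous_map euclideanreal euclideanreal (\<lambda>r. exp (- \<epsilon> * r))"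
    by (simp add: continuous_intros)
  ultimately have "continuous_map (mtopology_of X) euclideanreal
      ((\<lambda>r. exp (- \<epsilon> * r)) \<circ> (\<lambda>x. mdist X x p))"
    by (rule continuous_map_compose)
  then show ?thesis by (simp add: o_def conformal_density_def[abs_def])
qed

lemma conformal_density_ratio:
  assumes "x \<in> mspace X" "y \<in> mspace X" "p \<in> mspace X" and "0 \<le> \<epsilon>"
  shows "exp (- \<epsilon> * mdist X x y) \<le> conformal_density X p \<epsilon> x / conformal_density X p \<epsilon> y"
    and "conformal_density X p \<epsilon> x / conformal_density X p \<epsilon> y \<le> exp (\<epsilon> * mdist X x y)"
proof -
  have "mdist X x p \<le> mdist X x y + mdist X y p" "mdist X y p \<le> mdist X x y + mdist X x p"
    using assms mdist_commute[of X x y] mdist_triangle[of x X y p] mdist_triangle[of y X x p]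
    by auto
  then have "\<epsilon> * mdist X x p \<le> \<epsilon> * (mdist X x y + mdist X y p)"
    "\<epsilon> * mdist X y p \<le> \<epsilon> * (mdist X x y + mdist X x p)"
    using assms(4) by (auto intro: mult_left_mono)
  then show "exp (- \<epsilon> * mdist X x y) \<le> conformal_density X p \<epsilon> x / conformal_density X p \<epsilon> y"
    "conformal_density X p \<epsilon> x / conformal_density X p \<epsilon> y \<le> exp (\<epsilon> * mdist X x y)"
    unfolding conformal_density_def exp_diff[symmetric] by (auto simp: algebra_simps)
qed

text \<open>Line integrals have been bounded below on nearly shortest curves only, whereas the conformal
  distance is an infimum over all curves. The Gehring--Hayman inequality bridges the gap: up to a factor \<open>K\<close>, no curve
  is conformally shorter than a short arc.\<close>

lemma conformal_dist_ge_exp_gromov_product: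
  fixes X :: "'a metric"
  assumes X: "intrinsic X" "hyperbolic_space \<delta> X" and p: "p \<in> mspace X"
    and h: "0 < h" and gh: "gehring_hayman_constant TYPE('a) \<delta> h \<epsilon>\<^sub>0"
    and \<epsilon>: "0 < \<epsilon>" "\<epsilon> \<le> \<epsilon>\<^sub>0"
  obtains c where "0 < c"
    "\<And>x y. x \<in> mspace X \<Longrightarrow> y \<in> mspace X \<Longrightarrow>
       c * exp (- \<epsilon> * gromov_product X p x y) * min 1 (mdist X x y) \<le> conformal_dist X p \<epsilon> x y"
proof -
  let ?\<rho> = "conformal_density X p \<epsilon>"
  have \<rho>: "intrinsic X \<and> hyperbolic_space \<delta> X \<and> 0 < \<epsilon> \<and> \<epsilon> \<le> \<epsilon>\<^sub>0 \<and>
      continuous_map (mtopology_of X) euclideanreal ?\<rho> \<and> (\<forall>x\<in>mspace X. 0 < ?\<rho> x) \<and>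
      (\<forall>x\<in>mspace X. \<forall>y\<in>mspace X.
         exp (- \<epsilon> * mdist X x y) \<le> ?\<rho> x / ?\<rho> y \<and> ?\<rho> x / ?\<rho> y \<le> exp (\<epsilon> * mdist X x y))"
    using X \<epsilon> by (intro conjI ballI continuous_map_conformal_density p
        conformal_density_ratio[OF _ _ p less_imp_le[OF \<epsilon>(1)]]) (auto simp: conformal_density_def)
  obtain K where K: "0 < K" and "\<forall>(Y :: 'a metric) \<epsilon> \<rho>.
      intrinsic Y \<and> hyperbolic_space \<delta> Y \<and> 0 < \<epsilon> \<and> \<epsilon> \<le> \<epsilon>\<^sub>0 \<and>
      continuous_map (mtopology_of Y) euclideanreal \<rho> \<and> (\<forall>x\<in>mspace Y. 0 < \<rho> x) \<and>
      (\<forall>x\<in>mspace Y. \<forall>y\<in>mspace Y.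
         exp (- \<epsilon> * mdist Y x y) \<le> \<rho> x / \<rho> y \<and> \<rho> x / \<rho> y \<le> exp (\<epsilon> * mdist Y x y))
      \<longrightarrow> (\<forall>x y \<alpha> a b \<gamma> c e.
            short_arc Y h \<alpha> a b x y \<and> path_length Y \<alpha> a b \<le> ennreal (2 * mdist Y x y) \<and>
            curve_between Y \<gamma> c e x y \<and> rectifiable Y \<gamma> c e
            \<longrightarrow> line_integral Y \<rho> \<alpha> a b \<le> K * line_integral Y \<rho> \<gamma> c e)"
    using gh unfolding gehring_hayman_constant_def by (elim conjE exE) (rule that)
  from this(2)[THEN spec, of X, THEN spec, of \<epsilon>, THEN spec, of ?\<rho>, THEN mp, OF \<rho>]
  have GH: "line_integral X ?\<rho> \<alpha> a b \<le> K * line_integral X ?\<rho> \<gamma> c e"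
    if "short_arc X h \<alpha> a b x y" "path_length X \<alpha> a b \<le> ennreal (2 * mdist X x y)"
      "curve_between X \<gamma> c e x y" "rectifiable X \<gamma> c e" for x y \<alpha> a b \<gamma> c e
    using that by blast
  define c where "c = exp (- \<epsilon> * (2 * \<delta> + h + 1)) / K"
  show thesis
  proof (rule that)
    show "0 < c" using K by (simp add: c_def)
    fix x y assume xy: "x \<in> mspace X" "y \<in> mspace X"
    let ?P = "gromov_product X p x y"
    show "c * exp (- \<epsilon> * ?P) * min 1 (mdist X x y) \<le> conformal_dist X p \<epsilon> x y"
    proof (rule conformal_dist_greatest[OF X(1) xy])
      fix \<gamma> s t assume \<gamma>: "curve_between X \<gamma> s t x y" "rectifiable X \<gamma> s t"
      show "c * exp (- \<epsilon> * ?P) * min 1 (mdist X x y)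
          \<le> line_integral X (conformal_density X p \<epsilon>) \<gamma> s t"
      proof (cases "x = y")
        case True
        then have "mdist X x y = 0" using xy by simp
        then show ?thesis using line_integral_conformal_density_nonneg[OF \<gamma> p] by simp
      next
        case False
        then have d: "0 < mdist X x y" using xy mdist_zero[of x X y] mdist_nonneg[of X x y] by linarith
        \<comment> \<open>An excess of at most \<open>h\<close> and at most \<open>|x - y|\<close> meets both requirements of the inequality.\<close>
        then obtain \<alpha> a b where \<alpha>: "short_arc X (min h (mdist X x y)) \<alpha> a b x y"
          using intrinsic_short_arc[OF X(1) xy, of "min h (mdist X x y)"] h by auto
        have short: "short_arc X h \<alpha> a b x y"
          "path_length X \<alpha> a b \<le> ennreal (2 * mdist X x y)"
          using \<alpha> unfolding short_arc_def by (auto elim!: order_trans intro!: ennreal_leI)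
        have "exp (- \<epsilon> * (?P + 2 * \<delta> + h + 1)) * min 1 (mdist X x y)
            \<le> line_integral X (conformal_density X p \<epsilon>) \<alpha> a b"
          using short_arc_curve[OF short(1)] h
          by (intro line_integral_short_curve_ge[OF X(2) _ _ _ xy p _ \<epsilon>(1)]) auto
        also have "\<dots> \<le> K * line_integral X (conformal_density X p \<epsilon>) \<gamma> s t"
          using GH[OF short \<gamma>] .
        finally show ?thesis
          using K by (simp add: c_def field_simps flip: exp_add)
      qed
    qed
  qed
qed


section \<open>Limits in metric spaces and Gromov products\<close>

lemma limitin_mtopology_of_iff:
  "limitin (mtopology_of C) f l F \<longleftrightarrow>
     l \<in> mspace C \<and> (\<forall>\<^sub>F i in F. f i \<in> mspace C) \<and> ((\<lambda>i. mdist C (f i) l) \<longlongrightarrow> 0) F"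
  unfolding mtopology_of_def
  by (rule Metric_space.limitin_metric_dist_null[OF Metric_space_mspace_mdist])

lemma tendsto_mdist:
  assumes "limitin (mtopology_of C) f l F" "limitin (mtopology_of C) g m F"
  shows "((\<lambda>i. mdist C (f i) (g i)) \<longlongrightarrow> mdist C l m) F"
proof -
  have lm: "l \<in> mspace C" "m \<in> mspace C"
    and in_C: "\<forall>\<^sub>F i in F. f i \<in> mspace C" "\<forall>\<^sub>F i in F. g i \<in> mspace C"
    and lim: "((\<lambda>i. mdist C (f i) l) \<longlongrightarrow> 0) F" "((\<lambda>i. mdist C (g i) m) \<longlongrightarrow> 0) F"
    using assms by (auto simp: limitin_mtopology_of_iff)
  have "\<forall>\<^sub>F i in F. norm (mdist C (f i) (g i) - mdist C l m) \<le> mdist C (f i) l + mdist C (g i) m"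
    using in_C
  proof eventually_elim
    case (elim i)
    have "mdist C (f i) (g i) \<le> mdist C (f i) l + mdist C l (g i)"
      "mdist C l (g i) \<le> mdist C l m + mdist C m (g i)"
      "mdist C l m \<le> mdist C l (f i) + mdist C (f i) m"
      "mdist C (f i) m \<le> mdist C (f i) (g i) + mdist C (g i) m"
      using lm elim by (auto intro: mdist_triangle)
    then show ?case
      using mdist_commute[of C l "f i"] mdist_commute[of C m "g i"] by auto
  qed
  moreover have "((\<lambda>i. mdist C (f i) l + mdist C (g i) m) \<longlongrightarrow> 0) F"
    using tendsto_add[OF lim] by simp
  ultimately have "((\<lambda>i. mdist C (f i) (g i) - mdist C l m) \<longlongrightarrow> 0) F"
    by (rule Lim_null_comparison)
  then show ?thesis by (simp add: LIM_zero_iff)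
qed

lemma gromov_product_nonneg:
  assumes "x \<in> mspace X" "y \<in> mspace X" "q \<in> mspace X"
  shows "0 \<le> gromov_product X q x y"
  using mdist_triangle[of x X q y] mdist_commute[of X q y] assms
  by (simp add: gromov_product_def)

lemma gromov_product_le_mdist:
  assumes "x \<in> mspace X" "y \<in> mspace X" "q \<in> mspace X"
  shows "gromov_product X q x y \<le> mdist X x q"
  using mdist_triangle[of y X x q] mdist_commute[of X y x] assms
  by (simp add: gromov_product_def)

lemma gromov_product_self: "x \<in> mspace X \<Longrightarrow> gromov_product X q x x = mdist X x q"
  using mdist_zero[of x X x] by (simp add: gromov_product_def)

lemma gromov_product_change_basepoint:
  assumes "x \<in> mspace X" "y \<in> mspace X" "p \<in> mspace X" "q \<in> mspace X"
  shows "gromov_product X p x y \<le> gromov_product X q x y + mdist X p q"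
  using mdist_triangle[of x X q p] mdist_triangle[of y X q p] mdist_commute[of X q p] assms
  by (simp add: gromov_product_def field_simps)

lemma gromov_sequence_at_top:
  assumes "gromov_sequence X q u"
  shows "filterlim (\<lambda>n. mdist X (u n) q) at_top sequentially"
proof (unfold filterlim_at_top, intro allI)
  fix Z
  have "\<forall>\<^sub>F (i, j) in sequentially \<times>\<^sub>F sequentially. Z \<le> gromov_product X q (u i) (u j)"
    using assms by (auto simp: gromov_sequence_def filterlim_at_top split_def)
  then obtain N where "\<And>n. n \<ge> N \<Longrightarrow> Z \<le> gromov_product X q (u n) (u n)"
    by (auto simp: eventually_prod_sequentially)
  moreover have "gromov_product X q (u n) (u n) = mdist X (u n) q" for n
    using assms by (intro gromov_product_self) (auto simp: gromov_sequence_def)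
  ultimately show "\<forall>\<^sub>F n in sequentially. Z \<le> mdist X (u n) q"
    by (auto simp: eventually_sequentially)
qed

lemma gromov_sequence_mspace: "gromov_sequence X q u \<Longrightarrow> u n \<in> mspace X"
  by (auto simp: gromov_sequence_def)

lemma gromov_equiv_refl: "gromov_sequence X q u \<Longrightarrow> (u, u) \<in> gromov_equiv X q"
  using gromov_sequence_at_top[of X q u]
  by (simp add: gromov_equiv_def gromov_product_self gromov_sequence_mspace)

lemma gromov_boundaryE:
  assumes "\<xi> \<in> gromov_boundary X q"
  obtains u where "gromov_sequence X q u" "\<xi> = gromov_equiv X q `` {u}"
  using assms by (auto simp: gromov_boundary_def quotient_def)

lemma gromov_boundary_member:
  assumes "\<xi> \<in> gromov_boundary X q"
  shows "\<xi> \<noteq> {}" and "u \<in> \<xi> \<Longrightarrow> gromov_sequence X q u"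
  using assms by (auto elim!: gromov_boundaryE dest: gromov_equiv_refl simp: gromov_equiv_def)


section \<open>From the distance estimates to the boundary map\<close>

text \<open>All that the boundary map needs of the conformal distance is the two-sided estimate by
  \<open>exp (- \<epsilon> * (x|y))\<close>, cut off for nearby points, and that the original metric dominates it. The
  boundary map is therefore constructed for any such function \<open>d\<close>. The base point is the one
  of the visual metametric; moving it changes Gromov products by a bounded amount, which
  can be absorbed in \<open>c\<close> and \<open>B\<close>.\<close>

locale visual_distance =
  fixes X :: "'a metric" and q :: 'a and \<epsilon> c B :: real
    and d :: "'a \<Rightarrow> 'a \<Rightarrow> real" and C :: "'c metric" and \<iota> :: "'a \<Rightarrow> 'c"
  assumes q: "q \<in> mspace X" and \<epsilon>: "0 < \<epsilon>" and c: "0 < c" and B: "0 < B"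
    and upper: "\<And>x y. x \<in> mspace X \<Longrightarrow> y \<in> mspace X \<Longrightarrow>
      d x y \<le> B * exp (- \<epsilon> * gromov_product X q x y)"
    and lower: "\<And>x y. x \<in> mspace X \<Longrightarrow> y \<in> mspace X \<Longrightarrow>
      c * exp (- \<epsilon> * gromov_product X q x y) * min 1 (mdist X x y) \<le> d x y"
    and le_mdist: "\<And>x y. x \<in> mspace X \<Longrightarrow> y \<in> mspace X \<Longrightarrow> d x y \<le> mdist X x y"
    and completion: "is_metric_completion (mspace X) d C \<iota>"
begin

lemma \<iota>_in: "x \<in> mspace X \<Longrightarrow> \<iota> x \<in> mspace C"
  using completion by (auto simp: is_metric_completion_def)

lemma mdist_\<iota>: "x \<in> mspace X \<Longrightarrow> y \<in> mspace X \<Longrightarrow> mdist C (\<iota> x) (\<iota> y) = d x y"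
  using completion by (auto simp: is_metric_completion_def)

lemma limitin_unique:
  assumes "limitin (mtopology_of C) s z sequentially" "limitin (mtopology_of C) s w sequentially"
  shows "z = w"
  using Metric_space.limitin_metric_unique[OF Metric_space_mspace_mdist[of C]] assms
  unfolding mtopology_of_def by (metis trivial_limit_sequentially)

lemma exp_small:
  assumes "0 < e"
  obtains Z where "\<And>r. Z \<le> r \<Longrightarrow> B * exp (- \<epsilon> * r) < e"
proof (rule that)
  \<comment> \<open>The summand \<open>1\<close> makes the inequality strict.\<close>
  fix r assume "(1 - ln (e / B)) / \<epsilon> \<le> r"
  then have "1 - ln (e / B) \<le> \<epsilon> * r" using \<epsilon> by (simp add: field_simps)
  then have "exp (- \<epsilon> * r) < exp (ln (e / B))" by (subst exp_less_cancel_iff) simp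
  then show "B * exp (- \<epsilon> * r) < e" using assms B by (simp add: field_simps)
qed

lemma dist_le_exp:
  assumes "x \<in> mspace X" "y \<in> mspace X" "l \<le> gromov_product X q x y"
  shows "d x y \<le> B * exp (- \<epsilon> * l)"
proof -
  have "B * exp (- \<epsilon> * gromov_product X q x y) \<le> B * exp (- \<epsilon> * l)"
    using assms(3) \<epsilon> B by (intro mult_left_mono) auto
  then show ?thesis using upper[OF assms(1,2)] by simp
qed

lemma dist_ge_exp:
  assumes "x \<in> mspace X" "y \<in> mspace X" "gromov_product X q x y \<le> l"
  shows "c * exp (- \<epsilon> * l) * min 1 (mdist X x y) \<le> d x y"
proof -
  have "c * exp (- \<epsilon> * l) * min 1 (mdist X x y)
      \<le> c * exp (- \<epsilon> * gromov_product X q x y) * min 1 (mdist X x y)"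
    using assms(3) \<epsilon> c by (intro mult_right_mono mult_left_mono) auto
  then show ?thesis using lower[OF assms(1,2)] by simp
qed

text \<open>Two points whose Gromov product is much smaller than their distances to the base point are
  far from each other, so that the cut-off \<open>min 1\<close> in the lower bound disappears.\<close>

lemma dist_ge_exp_far:
  assumes "x \<in> mspace X" "y \<in> mspace X" "gromov_product X q x y \<le> l"
    and "2 * l + 1 \<le> mdist X x q + mdist X y q"
  shows "c * exp (- \<epsilon> * l) \<le> d x y"
proof -
  have "1 \<le> mdist X x y" using assms(3,4) by (simp add: gromov_product_def)
  then show ?thesis using dist_ge_exp[OF assms(1-3)] by (simp add: min_absorb1)
qed

lemma gromov_sequence_converges:
  assumes u: "gromov_sequence X q u"
  obtains z where "limitin (mtopology_of C) (\<lambda>n. \<iota> (u n)) z sequentially"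
proof -
  have uX: "u n \<in> mspace X" for n using u by (rule gromov_sequence_mspace)
  interpret C: Metric_space "mspace C" "mdist C" by simp
  have "C.MCauchy (\<lambda>n. \<iota> (u n))"
    unfolding C.MCauchy_def
  proof (intro conjI allI impI)
    show "range (\<lambda>n. \<iota> (u n)) \<subseteq> mspace C" using uX \<iota>_in by auto
    fix e :: real assume "0 < e"
    then obtain Z where Z: "\<And>r. Z \<le> r \<Longrightarrow> B * exp (- \<epsilon> * r) < e" using exp_small by blast
    have "\<forall>\<^sub>F (i, j) in sequentially \<times>\<^sub>F sequentially. Z \<le> gromov_product X q (u i) (u j)"
      using u by (auto simp: gromov_sequence_def filterlim_at_top split_def)
    then obtain N where N: "\<And>i j. N \<le> i \<Longrightarrow> N \<le> j \<Longrightarrow> Z \<le> gromov_product X q (u i) (u j)"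
      by (auto simp: eventually_prod_sequentially)
    have "mdist C (\<iota> (u i)) (\<iota> (u j)) < e" if "N \<le> i" "N \<le> j" for i j
      using dist_le_exp[OF uX uX N[OF that]] Z[of Z] uX by (simp add: mdist_\<iota>)
    then show "\<exists>N. \<forall>n n'. N \<le> n \<longrightarrow> N \<le> n' \<longrightarrow> mdist C (\<iota> (u n)) (\<iota> (u n')) < e"
      by blast
  qed
  moreover have "C.mcomplete"
    using completion by (simp add: is_metric_completion_def mcomplete_of_def)
  ultimately obtain z where "limitin C.mtopology (\<lambda>n. \<iota> (u n)) z sequentially"
    unfolding C.mcomplete_def by blast
  then show thesis by (intro that) (simp add: mtopology_of_def)
qed

text \<open>A Gromov sequence leaves every ball, whereas its Gromov products with a fixed point \<open>x\<close>
  stay below the distance from \<open>x\<close> to the base point. So the lower bound keeps \<open>d (u n) x\<close>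
  away from \<open>0\<close>.\<close>

lemma limit_notin_\<iota>:
  assumes u: "gromov_sequence X q u"
    and z: "limitin (mtopology_of C) (\<lambda>n. \<iota> (u n)) z sequentially"
  shows "z \<notin> \<iota> ` mspace X"
proof
  assume "z \<in> \<iota> ` mspace X"
  then obtain x where x: "x \<in> mspace X" "z = \<iota> x" by blast
  have uX: "u n \<in> mspace X" for n using u by (rule gromov_sequence_mspace)
  let ?m = "c * exp (- \<epsilon> * mdist X x q)"
  have "(\<lambda>n. d (u n) x) \<longlonglongrightarrow> 0"
    using z x uX by (simp add: limitin_mtopology_of_iff mdist_\<iota>)
  then have "\<forall>\<^sub>F n in sequentially. d (u n) x < ?m"
    using c by (intro order_tendstoD(2)) auto
  moreover have "\<forall>\<^sub>F n in sequentially. 2 * mdist X x q + 1 \<le> mdist X (u n) q"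
    using gromov_sequence_at_top[OF u] by (simp add: filterlim_at_top)
  ultimately have "\<forall>\<^sub>F n in sequentially. False"
  proof eventually_elim
    case (elim n)
    have "gromov_product X q (u n) x \<le> mdist X x q"
      using gromov_product_le_mdist[OF x(1) uX[of n] q] mdist_commute[of X x "u n"]
      by (simp add: gromov_product_def)
    moreover have "2 * mdist X x q + 1 \<le> mdist X (u n) q + mdist X x q"
      using elim(2) mdist_nonneg[of X x q] by linarith
    ultimately have "?m \<le> d (u n) x" by (rule dist_ge_exp_far[OF uX x(1)])
    then show False using elim by simp
  qed
  then show False by simp
qed

context
  fixes u v z w
  assumes u: "gromov_sequence X q u" and v: "gromov_sequence X q v"
    and z: "limitin (mtopology_of C) (\<lambda>n. \<iota> (u n)) z sequentially"
    and w: "limitin (mtopology_of C) (\<lambda>n. \<iota> (v n)) w sequentially"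
begin

lemma dist_tendsto: "(\<lambda>n. d (u n) (v n)) \<longlonglongrightarrow> mdist C z w"
  using tendsto_mdist[OF z w] gromov_sequence_mspace[OF u] gromov_sequence_mspace[OF v]
  by (simp add: mdist_\<iota>)

text \<open>The next two lemmas pass to the limit in the bounds for \<open>d (u n) (v n)\<close>. A strict
  inequality for the limit inferior is used in both: from below it holds for almost all indices,
  from above for infinitely many, which suffices because the distances converge.\<close>

lemma limit_dist_le:
  assumes "ereal l < liminf (\<lambda>n. ereal (gromov_product X q (u n) (v n)))"
  shows "mdist C z w \<le> B * exp (- \<epsilon> * l)"
proof (rule tendsto_upperbound[OF dist_tendsto])
  have "\<forall>\<^sub>F n in sequentially. ereal l < ereal (gromov_product X q (u n) (v n))"
    using assms by (rule less_LiminfD)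
  then show "\<forall>\<^sub>F n in sequentially. d (u n) (v n) \<le> B * exp (- \<epsilon> * l)"
  proof eventually_elim
    case (elim n)
    then show ?case
      using gromov_sequence_mspace[OF u] gromov_sequence_mspace[OF v] by (intro dist_le_exp) auto
  qed
qed simp

lemma limit_dist_ge:
  assumes "liminf (\<lambda>n. ereal (gromov_product X q (u n) (v n))) < ereal l"
  shows "c * exp (- \<epsilon> * l) \<le> mdist C z w"
proof (rule ccontr)
  assume "\<not> c * exp (- \<epsilon> * l) \<le> mdist C z w"
  then have "\<forall>\<^sub>F n in sequentially. d (u n) (v n) < c * exp (- \<epsilon> * l)"
    using dist_tendsto by (intro order_tendstoD(2)) auto
  moreover have "\<forall>\<^sub>F n in sequentially. 2 * l + 1 \<le> mdist X (u n) q"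
    using gromov_sequence_at_top[OF u] by (simp add: filterlim_at_top)
  ultimately have "\<forall>\<^sub>F n in sequentially. ereal l \<le> ereal (gromov_product X q (u n) (v n))"
  proof eventually_elim
    case (elim n)
    have "2 * l + 1 \<le> mdist X (u n) q + mdist X (v n) q"
      using elim(2) mdist_nonneg[of X "v n" q] by linarith
    then have "c * exp (- \<epsilon> * l) \<le> d (u n) (v n)" if "gromov_product X q (u n) (v n) \<le> l"
      using dist_ge_exp_far[OF gromov_sequence_mspace[OF u] gromov_sequence_mspace[OF v] that] by blast
    then show ?case using elim(1) by force
  qed
  then have "ereal l \<le> liminf (\<lambda>n. ereal (gromov_product X q (u n) (v n)))"
    by (rule Liminf_bounded)
  then show False using assms by simp
qed

end

lemma equivalent_sequences_same_limit:
  assumes uv: "(u, v) \<in> gromov_equiv X q"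
    and z: "limitin (mtopology_of C) (\<lambda>n. \<iota> (u n)) z sequentially"
  shows "limitin (mtopology_of C) (\<lambda>n. \<iota> (v n)) z sequentially"
proof -
  have u: "gromov_sequence X q u" and v: "gromov_sequence X q v"
    and lim: "filterlim (\<lambda>n. gromov_product X q (u n) (v n)) at_top sequentially"
    using uv by (auto simp: gromov_equiv_def)
  obtain w where w: "limitin (mtopology_of C) (\<lambda>n. \<iota> (v n)) w sequentially"
    using gromov_sequence_converges[OF v] .
  have "mdist C z w \<le> 0"
  proof (rule field_le_epsilon)
    fix e :: real assume "0 < e"
    then obtain Z where Z: "\<And>r. Z \<le> r \<Longrightarrow> B * exp (- \<epsilon> * r) < e" using exp_small by blast
    have "\<forall>\<^sub>F n in sequentially. ereal (Z + 1) \<le> ereal (gromov_product X q (u n) (v n))"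
      using lim by (simp add: filterlim_at_top)
    then have "ereal (Z + 1) \<le> liminf (\<lambda>n. ereal (gromov_product X q (u n) (v n)))"
      by (rule Liminf_bounded)
    then have "ereal Z < liminf (\<lambda>n. ereal (gromov_product X q (u n) (v n)))"
      by (rule less_le_trans[rotated]) simp
    from limit_dist_le[OF u v z w this] show "mdist C z w \<le> 0 + e"
      using Z[of Z] by simp
  qed
  moreover have "z \<in> mspace C" "w \<in> mspace C"
    using z w by (auto simp: limitin_mtopology_of_iff)
  ultimately have "z = w"
    using mdist_nonneg[of C z w] mdist_zero[of z C w] by linarith
  then show ?thesis using w by simp
qed

lemma ex_boundary_map:
  "\<exists>f. \<forall>\<xi>\<in>gromov_boundary X q. \<forall>u\<in>\<xi>.
     limitin (mtopology_of C) (\<lambda>n. \<iota> (u n)) (f \<xi>) sequentially"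
proof -
  have "\<forall>\<xi>\<in>gromov_boundary X q. \<exists>z. \<forall>u\<in>\<xi>.
      limitin (mtopology_of C) (\<lambda>n. \<iota> (u n)) z sequentially"
  proof
    fix \<xi> assume "\<xi> \<in> gromov_boundary X q"
    then obtain u where u: "gromov_sequence X q u" and \<xi>: "\<xi> = gromov_equiv X q `` {u}"
      by (rule gromov_boundaryE)
    obtain z where "limitin (mtopology_of C) (\<lambda>n. \<iota> (u n)) z sequentially"
      using gromov_sequence_converges[OF u] .
    then show "\<exists>z. \<forall>u\<in>\<xi>. limitin (mtopology_of C) (\<lambda>n. \<iota> (u n)) z sequentially"
      using equivalent_sequences_same_limit \<xi> by blast
  qed
  then show ?thesis by (rule bchoice)
qed

text \<open>The extended Gromov product is an infimum over representing sequences, while the limits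
  \<open>z\<close> and \<open>w\<close> are the same for all of them. Hence one pair of sequences gives the upper bound
  and a nearly optimal pair the lower one. Moving the exponent by \<open>1\<close> provides the strict
  inequalities and costs a factor \<open>exp \<epsilon>\<close>.\<close>

lemma boundary_dist_bounds:
  assumes \<xi>: "\<xi> \<in> gromov_boundary X q" and \<eta>: "\<eta> \<in> gromov_boundary X q"
    and z: "\<And>u. u \<in> \<xi> \<Longrightarrow> limitin (mtopology_of C) (\<lambda>n. \<iota> (u n)) z sequentially"
    and w: "\<And>v. v \<in> \<eta> \<Longrightarrow> limitin (mtopology_of C) (\<lambda>n. \<iota> (v n)) w sequentially"
  shows "mdist C z w \<le> B * exp \<epsilon> * visual_tau X q \<epsilon> (Inr \<xi>) (Inr \<eta>)"
    and "c * exp (- \<epsilon>) * visual_tau X q \<epsilon> (Inr \<xi>) (Inr \<eta>) \<le> mdist C z w"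
proof -
  let ?L = "\<lambda>u v. liminf (\<lambda>n. ereal (gromov_product X q (u n) (v n)))"
  define E where "E = ext_gromov_product X q (Inr \<xi>) (Inr \<eta>)"
  have E: "E = (INF u\<in>\<xi>. INF v\<in>\<eta>. ?L u v)"
    by (simp only: E_def ext_gromov_product_def representing_sequences.simps)
  have le: "mdist C z w \<le> B * exp (- \<epsilon> * l)" if "ereal l < E" for l
  proof -
    obtain u v where uv: "u \<in> \<xi>" "v \<in> \<eta>"
      using gromov_boundary_member(1)[OF \<xi>] gromov_boundary_member(1)[OF \<eta>] by blast
    have "E \<le> ?L u v" unfolding E
      by (rule INF_lower2[OF uv(1)]) (rule INF_lower[OF uv(2)])
    then have "ereal l < ?L u v" using that by simp
    from limit_dist_le[OF _ _ z[OF uv(1)] w[OF uv(2)] this] show ?thesis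
      using gromov_boundary_member(2)[OF \<xi> uv(1)] gromov_boundary_member(2)[OF \<eta> uv(2)] by blast
  qed
  have ge: "c * exp (- \<epsilon> * l) \<le> mdist C z w" if l: "E < ereal l" for l
  proof -
    obtain u v where uv: "u \<in> \<xi>" "v \<in> \<eta>" "?L u v < ereal l"
      using l unfolding E by (auto simp: INF_less_iff)
    from limit_dist_ge[OF _ _ z[OF uv(1)] w[OF uv(2)] uv(3)] show ?thesis
      using gromov_boundary_member(2)[OF \<xi> uv(1)] gromov_boundary_member(2)[OF \<eta> uv(2)] by blast
  qed
  have "0 \<le> E"
    unfolding E
  proof (intro INF_greatest Liminf_bounded always_eventually allI)
    fix u v n assume "u \<in> \<xi>" "v \<in> \<eta>"
    then have uv: "gromov_sequence X q u" "gromov_sequence X q v"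
      using gromov_boundary_member(2)[OF \<xi>] gromov_boundary_member(2)[OF \<eta>] by auto
    show "0 \<le> ereal (gromov_product X q (u n) (v n))"
      using gromov_product_nonneg[OF uv[THEN gromov_sequence_mspace] q] by simp
  qed
  then consider "E = \<infinity>" | r where "E = ereal r" by (cases E) auto
  then have "mdist C z w \<le> B * exp \<epsilon> * visual_tau X q \<epsilon> (Inr \<xi>) (Inr \<eta>) \<and>
      c * exp (- \<epsilon>) * visual_tau X q \<epsilon> (Inr \<xi>) (Inr \<eta>) \<le> mdist C z w"
  proof cases
    case 1
    have "mdist C z w \<le> 0"
    proof (rule field_le_epsilon)
      fix e :: real assume "0 < e"
      then obtain Z where Z: "\<And>r. Z \<le> r \<Longrightarrow> B * exp (- \<epsilon> * r) < e" using exp_small by blast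
      show "mdist C z w \<le> 0 + e" using le[of Z] Z[of Z] 1 by simp
    qed
    then show ?thesis using 1 by (simp add: visual_tau_def E_def)
  next
    case 2
    have \<tau>: "visual_tau X q \<epsilon> (Inr \<xi>) (Inr \<eta>) = exp (- \<epsilon> * r)"
      using 2 by (simp add: visual_tau_def E_def)
    have "mdist C z w \<le> B * exp (- \<epsilon> * (r - 1))" using le[of "r - 1"] 2 by simp
    moreover have "exp (- \<epsilon> * (r - 1)) = exp \<epsilon> * exp (- \<epsilon> * r)"
      by (simp add: algebra_simps flip: exp_add)
    moreover have "c * exp (- \<epsilon> * (r + 1)) \<le> mdist C z w" using ge[of "r + 1"] 2 by simp
    moreover have "exp (- \<epsilon> * (r + 1)) = exp (- \<epsilon>) * exp (- \<epsilon> * r)"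
      by (simp add: algebra_simps flip: exp_add)
    ultimately show ?thesis unfolding \<tau> by (simp add: mult.assoc)
  qed
  then show "mdist C z w \<le> B * exp \<epsilon> * visual_tau X q \<epsilon> (Inr \<xi>) (Inr \<eta>)"
    and "c * exp (- \<epsilon>) * visual_tau X q \<epsilon> (Inr \<xi>) (Inr \<eta>) \<le> mdist C z w" by auto
qed

lemma ex_approximating_sequence:
  assumes "z \<in> mspace C"
  obtains x where "\<And>n. x n \<in> mspace X"
    "limitin (mtopology_of C) (\<lambda>n. \<iota> (x n)) z sequentially"
proof -
  interpret C: Metric_space "mspace C" "mdist C" by simp
  have "mtopology_of C closure_of (\<iota> ` mspace X) = mspace C"
    using completion unfolding is_metric_completion_def by (elim conjE)
  then have "z \<in> C.mtopology closure_of (\<iota> ` mspace X)"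
    using assms by (simp only: mtopology_of_def)
  then have "\<forall>r>0. \<exists>y\<in>\<iota> ` mspace X. y \<in> C.mball z r"
    unfolding C.metric_closure_of by blast
  then have "\<exists>x\<in>mspace X. mdist C (\<iota> x) z < inverse (real (Suc n))" for n
    using mdist_commute[of C z] by (elim allE[of _ "inverse (real (Suc n))"]) auto
  then obtain x where x: "\<And>n. x n \<in> mspace X" "\<And>n. mdist C (\<iota> (x n)) z < inverse (real (Suc n))"
    by metis
  have "(\<lambda>n. mdist C (\<iota> (x n)) z) \<longlonglongrightarrow> 0"
    using x(2) by (intro Lim_null_comparison[OF _ LIMSEQ_inverse_real_of_nat] always_eventually)
      (auto intro: less_imp_le)
  then show thesis
    using x(1) assms \<iota>_in by (intro that[of x]) (auto simp: limitin_mtopology_of_iff)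
qed

lemma approximating_sequence_Cauchy:
  assumes x: "\<And>n. x n \<in> mspace X"
    and z: "limitin (mtopology_of C) (\<lambda>n. \<iota> (x n)) z sequentially" and "0 < e"
  obtains N where "\<And>m n. N \<le> m \<Longrightarrow> N \<le> n \<Longrightarrow> d (x m) (x n) < e"
proof -
  interpret C: Metric_space "mspace C" "mdist C" by simp
  have "C.MCauchy (\<lambda>n. \<iota> (x n))"
    using x z \<iota>_in by (intro C.convergent_imp_MCauchy[of _ z]) (auto simp: mtopology_of_def)
  then obtain N where "\<And>m n. N \<le> m \<Longrightarrow> N \<le> n \<Longrightarrow> mdist C (\<iota> (x m)) (\<iota> (x n)) < e"
    using \<open>0 < e\<close> unfolding C.MCauchy_def by meson
  then show thesis using x by (intro that[of N]) (simp add: mdist_\<iota>)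
qed

text \<open>This is where completeness of \<open>X\<close> enters. On a ball of \<open>X\<close> Gromov products are
  bounded, so there the lower bound turns a Cauchy sequence for \<open>d\<close> into one for the metric of
  \<open>X\<close>. Its limit in \<open>X\<close> would also be its limit in the completion, since \<open>d\<close> is dominated by
  the metric of \<open>X\<close>.\<close>

lemma approximating_sequence_unbounded:
  assumes X: "mcomplete_of X" and x: "\<And>n. x n \<in> mspace X"
    and z: "limitin (mtopology_of C) (\<lambda>n. \<iota> (x n)) z sequentially" and "z \<notin> \<iota> ` mspace X"
  shows "filterlim (\<lambda>n. mdist X (x n) q) at_top sequentially"
proof (rule ccontr)
  assume "\<not> ?thesis"
  then obtain R where "\<And>N. \<exists>n\<ge>N. mdist X (x n) q < R"
    by (auto simp: filterlim_at_top eventually_sequentially not_le)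
  then obtain r where r: "\<And>N. N \<le> r N" "\<And>N. mdist X (x (r N)) q < R"
    by metis
  \<comment> \<open>\<open>r\<close> tends to infinity without being strictly increasing, which suffices for limits.\<close>
  define y where "y = (\<lambda>n. x (r n))"
  have y: "y n \<in> mspace X" "mdist X (y n) q < R" for n using x r by (auto simp: y_def)
  have "filterlim r at_top sequentially"
    using r(1) by (intro filterlim_at_top_mono[OF filterlim_ident]) auto
  then have yz: "limitin (mtopology_of C) (\<lambda>n. \<iota> (y n)) z sequentially"
    using z y(1) \<iota>_in unfolding limitin_mtopology_of_iff y_def
    by (auto intro: filterlim_compose[of "\<lambda>n. mdist C (\<iota> (x n)) z"])
  interpret X: Metric_space "mspace X" "mdist X" by simp
  have "X.MCauchy y"
    unfolding X.MCauchy_def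
  proof (intro conjI allI impI)
    show "range y \<subseteq> mspace X" using y by auto
    fix e :: real assume "0 < e"
    define k where "k = c * exp (- \<epsilon> * R)"
    have k: "0 < k" using c by (simp add: k_def)
    then have "0 < k * min 1 e" using \<open>0 < e\<close> by simp
    then obtain N where N: "\<And>m n. N \<le> m \<Longrightarrow> N \<le> n \<Longrightarrow> d (y m) (y n) < k * min 1 e"
      using approximating_sequence_Cauchy[OF y(1) yz] by blast
    have "mdist X (y m) (y n) < e" if "N \<le> m" "N \<le> n" for m n
    proof -
      have "gromov_product X q (y m) (y n) \<le> R"
        using gromov_product_le_mdist[OF y(1) y(1) q] y(2) less_imp_le order_trans by metis
      then have "k * min 1 (mdist X (y m) (y n)) < k * min 1 e"
        using dist_ge_exp[OF y(1) y(1)] N[OF that] unfolding k_def by (meson order_le_less_trans)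
      then show ?thesis using k by (simp add: min_def split: if_splits)
    qed
    then show "\<exists>N. \<forall>n n'. N \<le> n \<longrightarrow> N \<le> n' \<longrightarrow> mdist X (y n) (y n') < e" by blast
  qed
  then obtain a where a: "limitin (mtopology_of X) y a sequentially"
    using X unfolding mcomplete_of_def X.mcomplete_def mtopology_of_def by blast
  then have aX: "a \<in> mspace X" by (simp add: limitin_mtopology_of_iff)
  have "(\<lambda>n. mdist C (\<iota> (y n)) (\<iota> a)) \<longlonglongrightarrow> 0"
  proof (rule Lim_null_comparison)
    show "\<forall>\<^sub>F n in sequentially. norm (mdist C (\<iota> (y n)) (\<iota> a)) \<le> mdist X (y n) a"
      using y aX le_mdist by (simp add: mdist_\<iota>[symmetric])
    show "(\<lambda>n. mdist X (y n) a) \<longlonglongrightarrow> 0" using a by (simp add: limitin_mtopology_of_iff)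
  qed
  then have "limitin (mtopology_of C) (\<lambda>n. \<iota> (y n)) (\<iota> a) sequentially"
    using y aX \<iota>_in by (simp add: limitin_mtopology_of_iff)
  then have "z = \<iota> a" using limitin_unique[OF yz] by blast
  then show False using aX assms(4) by blast
qed

text \<open>If \<open>(x n|x m)\<close> were below \<open>Z\<close> for points far out, these points would be at distance at
  least \<open>1\<close>, and the lower bound would contradict that the sequence is Cauchy for \<open>d\<close>.\<close>

lemma approximating_sequence_gromov:
  assumes X: "mcomplete_of X" and x: "\<And>n. x n \<in> mspace X"
    and z: "limitin (mtopology_of C) (\<lambda>n. \<iota> (x n)) z sequentially" and "z \<notin> \<iota> ` mspace X"
  shows "gromov_sequence X q x"
  unfolding gromov_sequence_def
proof (intro conjI)
  show "range x \<subseteq> mspace X" using x by auto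
  show "filterlim (\<lambda>(i, j). gromov_product X q (x i) (x j)) at_top (sequentially \<times>\<^sub>F sequentially)"
    unfolding filterlim_at_top
  proof
    fix Z :: real
    have "0 < c * exp (- \<epsilon> * Z)" using c by simp
    then obtain N1 where N1: "\<And>m n. N1 \<le> m \<Longrightarrow> N1 \<le> n \<Longrightarrow> d (x m) (x n) < c * exp (- \<epsilon> * Z)"
      using approximating_sequence_Cauchy[OF x z] by blast
    have "\<forall>\<^sub>F n in sequentially. Z + 1 \<le> mdist X (x n) q"
      using approximating_sequence_unbounded[OF assms] by (simp add: filterlim_at_top)
    then obtain N2 where N2: "\<And>n. N2 \<le> n \<Longrightarrow> Z + 1 \<le> mdist X (x n) q"
      by (auto simp: eventually_sequentially)
    have "Z \<le> gromov_product X q (x n) (x m)" if "max N1 N2 \<le> m" "max N1 N2 \<le> n" for m n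
    proof (rule ccontr)
      assume "\<not> Z \<le> gromov_product X q (x n) (x m)"
      then have "c * exp (- \<epsilon> * Z) \<le> d (x n) (x m)"
        using N2[of m] N2[of n] that by (intro dist_ge_exp_far x) auto
      then show False using N1[of n m] that by simp
    qed
    then show "\<forall>\<^sub>F ij in sequentially \<times>\<^sub>F sequentially. Z \<le> (case ij of (i, j) \<Rightarrow> gromov_product X q (x i) (x j))"
      unfolding eventually_prod_sequentially by (intro exI[of _ "max N1 N2"]) simp
  qed
qed

text \<open>Injectivity needs no separate argument: if two boundary points have the same image, the
  lower bound makes \<open>\<theta>\<close> vanish, and \<open>\<theta>\<close> separates points.\<close>

theorem boundary_map_bilipschitz:
  assumes \<theta>: "visual_metametric X q \<epsilon> \<theta>"
  shows "\<exists>f.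
      (\<forall>\<xi>\<in>gromov_boundary X q. f \<xi> \<in> mspace C - \<iota> ` mspace X \<and>
         (\<forall>u\<in>\<xi>. limitin (mtopology_of C) (\<lambda>n. \<iota> (u n)) (f \<xi>) sequentially)) \<and>
      inj_on f (gromov_boundary X q) \<and>
      (mcomplete_of X \<longrightarrow> bij_betw f (gromov_boundary X q) (mspace C - \<iota> ` mspace X)) \<and>
      (\<exists>A\<ge>1. \<forall>\<xi>\<in>gromov_boundary X q. \<forall>\<eta>\<in>gromov_boundary X q.
         \<theta> (Inr \<xi>) (Inr \<eta>) / A \<le> mdist C (f \<xi>) (f \<eta>) \<and>
         mdist C (f \<xi>) (f \<eta>) \<le> A * \<theta> (Inr \<xi>) (Inr \<eta>))"
proof -
  let ?G = "gromov_boundary X q"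
  obtain f where "\<forall>\<xi>\<in>?G. \<forall>u\<in>\<xi>.
      limitin (mtopology_of C) (\<lambda>n. \<iota> (u n)) (f \<xi>) sequentially"
    using ex_boundary_map by (rule exE)
  then have f: "limitin (mtopology_of C) (\<lambda>n. \<iota> (u n)) (f \<xi>) sequentially"
    if "\<xi> \<in> ?G" "u \<in> \<xi>" for \<xi> u
    using that by blast
  have f_in: "f \<xi> \<in> mspace C - \<iota> ` mspace X" if \<xi>: "\<xi> \<in> ?G" for \<xi>
  proof -
    obtain u where u: "u \<in> \<xi>" using gromov_boundary_member(1)[OF \<xi>] by blast
    have "gromov_sequence X q u" using gromov_boundary_member(2)[OF \<xi> u] .
    then show ?thesis
      using limit_notin_\<iota>[OF _ f[OF \<xi> u]] f[OF \<xi> u] by (auto simp: limitin_mtopology_of_iff)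
  qed
  have \<theta>: "0 \<le> \<theta> (Inr \<xi>) (Inr \<eta>)" "\<theta> (Inr \<xi>) (Inr \<eta>) = 0 \<Longrightarrow> \<xi> = \<eta>"
    "visual_tau X q \<epsilon> (Inr \<xi>) (Inr \<eta>) \<le> 2 * \<theta> (Inr \<xi>) (Inr \<eta>)"
    "\<theta> (Inr \<xi>) (Inr \<eta>) \<le> visual_tau X q \<epsilon> (Inr \<xi>) (Inr \<eta>)"
    if "\<xi> \<in> ?G" "\<eta> \<in> ?G" for \<xi> \<eta>
  proof -
    have "Inr \<xi> \<in> gromov_closure X q" "Inr \<eta> \<in> gromov_closure X q"
      using that by (auto simp: gromov_closure_def)
    then have *: "0 \<le> \<theta> (Inr \<xi>) (Inr \<eta>) \<and> (\<theta> (Inr \<xi>) (Inr \<eta>) = 0 \<longrightarrow> (Inr \<xi> :: 'a + _) = Inr \<eta>) \<and>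
        visual_tau X q \<epsilon> (Inr \<xi>) (Inr \<eta>) / 2 \<le> \<theta> (Inr \<xi>) (Inr \<eta>) \<and>
        \<theta> (Inr \<xi>) (Inr \<eta>) \<le> visual_tau X q \<epsilon> (Inr \<xi>) (Inr \<eta>)"
      using assms unfolding visual_metametric_def by blast
    then show "0 \<le> \<theta> (Inr \<xi>) (Inr \<eta>)" "\<theta> (Inr \<xi>) (Inr \<eta>) = 0 \<Longrightarrow> \<xi> = \<eta>"
      "visual_tau X q \<epsilon> (Inr \<xi>) (Inr \<eta>) \<le> 2 * \<theta> (Inr \<xi>) (Inr \<eta>)"
      "\<theta> (Inr \<xi>) (Inr \<eta>) \<le> visual_tau X q \<epsilon> (Inr \<xi>) (Inr \<eta>)"
      by auto
  qed
  define k where "k = c * exp (- \<epsilon>)"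
  have k: "0 < k" using c by (simp add: k_def)
  have low: "k * \<theta> (Inr \<xi>) (Inr \<eta>) \<le> mdist C (f \<xi>) (f \<eta>)"
    and up: "mdist C (f \<xi>) (f \<eta>) \<le> 2 * B * exp \<epsilon> * \<theta> (Inr \<xi>) (Inr \<eta>)"
    if "\<xi> \<in> ?G" "\<eta> \<in> ?G" for \<xi> \<eta>
  proof -
    have "k * \<theta> (Inr \<xi>) (Inr \<eta>) \<le> k * visual_tau X q \<epsilon> (Inr \<xi>) (Inr \<eta>)"
      using \<theta>(4)[OF that] k by (intro mult_left_mono) auto
    also have "\<dots> \<le> mdist C (f \<xi>) (f \<eta>)"
      unfolding k_def using that by (intro boundary_dist_bounds(2) f)
    finally show "k * \<theta> (Inr \<xi>) (Inr \<eta>) \<le> mdist C (f \<xi>) (f \<eta>)" .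
    have "mdist C (f \<xi>) (f \<eta>) \<le> B * exp \<epsilon> * visual_tau X q \<epsilon> (Inr \<xi>) (Inr \<eta>)"
      using that by (intro boundary_dist_bounds(1) f)
    also have "\<dots> \<le> B * exp \<epsilon> * (2 * \<theta> (Inr \<xi>) (Inr \<eta>))"
      using \<theta>(3)[OF that] B by (intro mult_left_mono) auto
    finally show "mdist C (f \<xi>) (f \<eta>) \<le> 2 * B * exp \<epsilon> * \<theta> (Inr \<xi>) (Inr \<eta>)"
      by (simp add: mult_ac)
  qed
  have inj: "inj_on f ?G"
  proof (rule inj_onI)
    fix \<xi> \<eta> assume G: "\<xi> \<in> ?G" "\<eta> \<in> ?G" and "f \<xi> = f \<eta>"
    then have "mdist C (f \<xi>) (f \<eta>) = 0"
      using f_in by simp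
    then have "k * \<theta> (Inr \<xi>) (Inr \<eta>) \<le> 0"
      using low[OF G] by simp
    then have "\<theta> (Inr \<xi>) (Inr \<eta>) = 0"
      using k \<theta>(1)[OF G] by (simp add: mult_le_0_iff)
    then show "\<xi> = \<eta>" using \<theta>(2)[OF G] by blast
  qed
  have surj: "z \<in> f ` ?G" if X: "mcomplete_of X" and z: "z \<in> mspace C - \<iota> ` mspace X" for z
  proof -
    obtain x where x: "\<And>n. x n \<in> mspace X"
      and lim: "limitin (mtopology_of C) (\<lambda>n. \<iota> (x n)) z sequentially"
      using ex_approximating_sequence[of z] z by blast
    have "gromov_sequence X q x"
      using approximating_sequence_gromov[OF X x lim] z by blast
    then have G: "gromov_equiv X q `` {x} \<in> ?G" and "x \<in> gromov_equiv X q `` {x}"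
      by (auto simp: gromov_boundary_def intro: quotientI gromov_equiv_refl)
    then have "f (gromov_equiv X q `` {x}) = z"
      using f lim limitin_unique by blast
    then show ?thesis using G by blast
  qed
  define A where "A = max 1 (max (1 / k) (2 * B * exp \<epsilon>))"
  have A: "1 \<le> A" "1 / k \<le> A" "2 * B * exp \<epsilon> \<le> A" by (auto simp: A_def)
  have "\<theta> (Inr \<xi>) (Inr \<eta>) / A \<le> mdist C (f \<xi>) (f \<eta>) \<and>
      mdist C (f \<xi>) (f \<eta>) \<le> A * \<theta> (Inr \<xi>) (Inr \<eta>)" if G: "\<xi> \<in> ?G" "\<eta> \<in> ?G" for \<xi> \<eta>
  proof
    have "\<theta> (Inr \<xi>) (Inr \<eta>) \<le> 1 / k * mdist C (f \<xi>) (f \<eta>)"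
      using low[OF G] k by (simp add: field_simps)
    also have "\<dots> \<le> A * mdist C (f \<xi>) (f \<eta>)"
      using A(2) by (rule mult_right_mono) simp
    finally show "\<theta> (Inr \<xi>) (Inr \<eta>) / A \<le> mdist C (f \<xi>) (f \<eta>)"
      using A(1) by (simp add: field_simps)
    have "2 * B * exp \<epsilon> * \<theta> (Inr \<xi>) (Inr \<eta>) \<le> A * \<theta> (Inr \<xi>) (Inr \<eta>)"
      using A(3) \<theta>(1)[OF G] by (rule mult_right_mono)
    then show "mdist C (f \<xi>) (f \<eta>) \<le> A * \<theta> (Inr \<xi>) (Inr \<eta>)" using up[OF G] by simp
  qed
  moreover have "bij_betw f ?G (mspace C - \<iota> ` mspace X)" if "mcomplete_of X"
  proof -
    have "f ` ?G = mspace C - \<iota> ` mspace X"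
      using f_in surj[OF that] by (intro equalityI subsetI) auto
    then show ?thesis using inj by (simp add: bij_betw_def)
  qed
  ultimately show ?thesis
    using f f_in inj A(1) by (intro exI[of _ f] conjI ballI impI exI[of _ A]) auto
qed

end


theorem theorem1p3:
  fixes X :: "'a metric" and q p :: 'a
    and \<delta> h \<epsilon>\<^sub>0 \<epsilon> :: real
    and \<theta> :: "'a + (nat \<Rightarrow> 'a) set \<Rightarrow> 'a + (nat \<Rightarrow> 'a) set \<Rightarrow> real"
    and C :: "'c metric" and \<iota> :: "'a \<Rightarrow> 'c"
  assumes "intrinsic X" and "hyperbolic_space \<delta> X"
    and "\<not> Metric_space.mbounded (mspace X) (mdist X) (mspace X)"
    and "q \<in> mspace X" and "p \<in> mspace X"
    and "0 < h" and "h < 1 / 13"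
    and "gehring_hayman_constant TYPE('a) \<delta> h \<epsilon>\<^sub>0"
    and "\<epsilon>\<^sub>0 < 1" and "\<delta> > 0 \<longrightarrow> \<epsilon>\<^sub>0 < 1 / (5 * \<delta>)"
    and "0 < \<epsilon>" and "\<epsilon> \<le> \<epsilon>\<^sub>0"
    and "is_metric_completion (mspace X) (conformal_dist X p \<epsilon>) C \<iota>"
    and "visual_metametric X q \<epsilon> \<theta>"
  shows "\<exists>f.
      (\<forall>\<xi>\<in>gromov_boundary X q. f \<xi> \<in> mspace C - \<iota> ` mspace X \<and>
         (\<forall>u\<in>\<xi>. limitin (mtopology_of C) (\<lambda>n. \<iota> (u n)) (f \<xi>) sequentially)) \<and>
      inj_on f (gromov_boundary X q) \<and>
      (mcomplete_of X \<longrightarrow> bij_betw f (gromov_boundary X q) (mspace C - \<iota> ` mspace X)) \<and>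
      (\<exists>A\<ge>1. \<forall>\<xi>\<in>gromov_boundary X q. \<forall>\<eta>\<in>gromov_boundary X q.
         \<theta> (Inr \<xi>) (Inr \<eta>) / A \<le> mdist C (f \<xi>) (f \<eta>) \<and>
         mdist C (f \<xi>) (f \<eta>) \<le> A * \<theta> (Inr \<xi>) (Inr \<eta>))"
proof -
  note X = \<open>intrinsic X\<close> \<open>hyperbolic_space \<delta> X\<close>
    and q = \<open>q \<in> mspace X\<close> and p = \<open>p \<in> mspace X\<close> and \<epsilon> = \<open>0 < \<epsilon>\<close> \<open>\<epsilon> \<le> \<epsilon>\<^sub>0\<close>
  obtain c where c: "0 < c" and lower: "\<And>x y. x \<in> mspace X \<Longrightarrow> y \<in> mspace X \<Longrightarrow>
      c * exp (- \<epsilon> * gromov_product X p x y) * min 1 (mdist X x y) \<le> conformal_dist X p \<epsilon> x y"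
    using conformal_dist_ge_exp_gromov_product[OF X p \<open>0 < h\<close>
        \<open>gehring_hayman_constant TYPE('a) \<delta> h \<epsilon>\<^sub>0\<close> \<epsilon>] by blast
  define s where "s = exp (\<epsilon> * mdist X p q)"
  have s: "0 < s" by (simp add: s_def)
  have pq: "exp (- \<epsilon> * gromov_product X p x y) \<le> s * exp (- \<epsilon> * gromov_product X q x y)"
    "exp (- \<epsilon> * gromov_product X q x y) \<le> s * exp (- \<epsilon> * gromov_product X p x y)"
    if "x \<in> mspace X" "y \<in> mspace X" for x y
  proof -
    have "gromov_product X p x y \<le> gromov_product X q x y + mdist X p q"
      "gromov_product X q x y \<le> gromov_product X p x y + mdist X p q"
      using that p q gromov_product_change_basepoint[of x X y p q]
        gromov_product_change_basepoint[of x X y q p] mdist_commute[of X p q] by auto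
    then have "\<epsilon> * gromov_product X p x y \<le> \<epsilon> * (gromov_product X q x y + mdist X p q)"
      "\<epsilon> * gromov_product X q x y \<le> \<epsilon> * (gromov_product X p x y + mdist X p q)"
      using \<epsilon> by (auto intro: mult_left_mono)
    then show "exp (- \<epsilon> * gromov_product X p x y) \<le> s * exp (- \<epsilon> * gromov_product X q x y)"
      "exp (- \<epsilon> * gromov_product X q x y) \<le> s * exp (- \<epsilon> * gromov_product X p x y)"
      by (auto simp: s_def algebra_simps simp flip: exp_add)
  qed
  interpret visual_distance X q \<epsilon> "c / s" "2 * exp \<epsilon> / \<epsilon> * s" "conformal_dist X p \<epsilon>" C \<iota>
  proof
    fix x y assume xy: "x \<in> mspace X" "y \<in> mspace X"
    have "conformal_dist X p \<epsilon> x y \<le> (2 * exp \<epsilon> / \<epsilon>) * exp (- \<epsilon> * gromov_product X p x y)"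
      using conformal_dist_le_exp_gromov_product[OF X(1) xy p \<epsilon>(1)] .
    also have "\<dots> \<le> (2 * exp \<epsilon> / \<epsilon>) * (s * exp (- \<epsilon> * gromov_product X q x y))"
      using pq(1)[OF xy] \<epsilon> by (intro mult_left_mono) auto
    finally show "conformal_dist X p \<epsilon> x y
        \<le> 2 * exp \<epsilon> / \<epsilon> * s * exp (- \<epsilon> * gromov_product X q x y)"
      by (simp add: mult.assoc)
    have "c / s * exp (- \<epsilon> * gromov_product X q x y) * min 1 (mdist X x y)
        \<le> c / s * (s * exp (- \<epsilon> * gromov_product X p x y)) * min 1 (mdist X x y)"
      using pq(2)[OF xy] c s by (intro mult_left_mono mult_right_mono) auto
    also have "\<dots> = c * exp (- \<epsilon> * gromov_product X p x y) * min 1 (mdist X x y)"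
      using s by simp
    also have "\<dots> \<le> conformal_dist X p \<epsilon> x y" using lower[OF xy] .
    finally show "c / s * exp (- \<epsilon> * gromov_product X q x y) * min 1 (mdist X x y)
        \<le> conformal_dist X p \<epsilon> x y" .
    show "conformal_dist X p \<epsilon> x y \<le> mdist X x y"
      using conformal_dist_le_mdist[OF X(1) xy p] \<epsilon> by simp
  qed (use assms c s in auto)
  show ?thesis
    using \<open>visual_metametric X q \<epsilon> \<theta>\<close> by (rule boundary_map_bilipschitz)
qed

end
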